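(* Let $0<\varrho<k\kappa$. There exist constants $\Lambda>0$, $c>0$ and $C_\#>0$ (depending on the fixed data, including $\varrho$, but not on $\ell$, $L$, $i$, or $e_{\ell_0}$), where $\Lambda$ satisfies $\sum_{i=1}^{N(\ell)}|\chi_i^{(\ell)}(y)|\le\Lambda$ for all $y\in\mathbb R^d$, $c$ satisfies $\|\chi_i^{(\ell)}-\check\chi_i^{(\ell)}\|_{L_\infty(\Omega)}\le c\,h_\ell^{\theta\varrho-d}$, and $C_\#$ satisfies $N(\ell)\le C_\#\mu^{-d\ell}$, such that for every $\ell_0<\ell\le L$ the local approximations $\check s_\ell$ produced with the local cardinal functions satisfy $$\|\bar s_\ell-\check s_\ell\|_{L_\infty(\Omega)}\le(1+\Lambda)^{\ell-\ell_0-1}\,\|e_{\ell_0}\|_{\ell^\infty(X_{\le\ell})}\,c\,C_\#\,h_\ell^{\theta\varrho-2d}+\Lambda\,\|\check e_{\ell-1}-\bar e_{\ell-1}\|_{L_\infty(\Omega)}.$$ Furthermore, if $\theta\varrho>2d$, then $$\|\bar e_\ell-\check e_\ell\|_{L_\infty(\Omega)}\le c\,C_\#\,(1+\Lambda)^{\ell-\ell_0-1}\,\|e_{\ell_0}\|_{\ell^\infty(X_{\le\ell})}\;2c_h\,h_{\ell_0+1}^{\theta\varrho-2d}.$$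
   Context: Notation: $\mathbb N=\{1,2,\dots\}$; $B(x;r)$ is the closed Euclidean ball in $\mathbb R^d$; $\Omega\subset\mathbb R^d$ is a bounded domain with Lipschitz boundary; $\|g\|_{\ell^\infty(Y)}:=\max_{y\in Y}|g(y)|$ for finite $Y$ ($0$ if $Y=\emptyset$). Kernel: $\tau>d/2$; $\Phi\in L_1(\mathbb R^d)$ is a real-valued radial function with $\operatorname{supp}\Phi\subset B(0;1)$ and $c_\Phi(1+\|\omega\|_2^2)^{-\tau}\le\widehat\Phi(\omega)\le C_\Phi(1+\|\omega\|_2^2)^{-\tau}$ for all $\omega$, with $c_\Phi,C_\Phi>0$. For $\delta>0$, $\Phi_\delta(x):=\delta^{-d}\Phi(x/\delta)$. Points: $(X_\ell)_{\ell\in\mathbb N}$ are finite sets $X_\ell=\{x_1^{(\ell)},\dots,x_{N(\ell)}^{(\ell)}\}\subset\Omega$ of distinct points, $X_1\subset\dots\subset X_L$, with $h_\ell:=\sup_{x\in\Omega}\min_{y\in X_\ell}\|x-y\|_2$ and $q_\ell:=\frac12\min_{i\ne j}\|x_i^{(\ell)}-x_j^{(\ell)}\|_2$. There are $k>1$, $\mu\in(0,k^{-1})$, $c_h\in(0,1]$, $c_q>0$, $c_\#>0$ such that for $1\le\ell\le L$: $c_h\mu h_\ell\le h_{\ell+1}\le\mu h_\ell$; $c_h\mu^\ell h_0\le h_\ell\le\mu^\ell h_0$ with $h_0:=h_1/\mu$; $q_\ell\le h_\ell\le c_q q_\ell$; $c_\#\mu^{-d\ell}\le N(\ell)$. For fixed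 $\gamma>0$ and a fixed $\nu\in[1/h_1,\gamma/\mu]$ put $\delta_\ell:=\nu h_\ell$, $\Phi_\ell(x,y):=\Phi_{\delta_\ell}(x-y)$. Cardinal functions: $W_\ell:=\operatorname{span}\{\Phi_\ell(\cdot,x_j^{(\ell)}):1\le j\le N(\ell)\}$; $\chi_i^{(\ell)}\in W_\ell$ is determined by $\chi_i^{(\ell)}(x_j^{(\ell)})=\delta_{ij}$. $A_{\ell,\ell}:=(\Phi_\ell(x_i^{(\ell)},x_j^{(\ell)}))_{i,j}$. Decay constant: $\theta>0$ is a fixed constant for which (known result) there are constants $c_A,c_\chi>0$ with, for all $1\le\ell\le L$, $1\le i,j\le N(\ell)$, $y\in\mathbb R^d$: $|(A_{\ell,\ell}^{-1})_{ij}|\le c_A q_\ell^d e^{-\theta\|x_i^{(\ell)}-x_j^{(\ell)}\|_2/q_\ell}$ and $|\chi_i^{(\ell)}(y)|\le c_\chi e^{-\theta\|x_i^{(\ell)}-y\|_2/q_\ell}$. Here $c_A=2(C_dc_\Phi)^{-1}(1+4M_d^2\nu^2c_q^2)^\tau e^{2\theta\sqrt d}$ and $c_\chi=c_A e^{c_q\nu\theta}(1+\nu c_q)^d$, with $C_d,M_d>0$ coming from the standard bounds on the condition number of $A_{\ell,\ell}$. Local cardinal functions: for $\varrho>0$, let $I_i^{(\ell)}:=X_\ell\cap B(x_i^{(\ell)};\varrho h_\ell|\log h_\ell|)$; $\check\chi_i^{(\ell)}\in\operatorname{span}\{\Phi_\ell(\cdot,x):x\in I_i^{(\ell)}\}$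 is determined by $\check\chi_i^{(\ell)}(x_i^{(\ell)})=1$ and $\check\chi_i^{(\ell)}(x)=0$ for $x\in I_i^{(\ell)}\setminus\{x_i^{(\ell)}\}$. Classical multiscale steps for a continuous target $f$ on $\Omega$: $e_0=f$, and for $1\le\ell\le\ell_0$, $s_\ell=\sum_i e_{\ell-1}(x_i^{(\ell)})\chi_i^{(\ell)}$, $e_\ell=e_{\ell-1}-s_\ell$; here $\ell_0:=\lceil k\mu/(1-k\mu)\rceil$. Adaptive steps (parameter $\kappa>0$, thresholds $\varepsilon_\ell>0$): $\bar e_{\ell_0}:=e_{\ell_0}$ and for $\ell_0<\ell\le L$: $X'_\ell:=\{x\in X_\ell:\ |\bar e_{\ell-1}(z)|\le\varepsilon_{\ell-1}\ \forall z\in X_L\cap B(x;k\kappa h_\ell|\log h_\ell|)\}$; $\bar X_\ell:=\bigcup_{x\in X'_\ell}(X_\ell\cap B(x;k\kappa h_\ell|\log h_\ell|))$; $\check X_\ell:=X_\ell\setminus\bar X_\ell$; $\bar s_\ell:=\sum_{x_i^{(\ell)}\in\check X_\ell}\bar e_{\ell-1}(x_i^{(\ell)})\chi_i^{(\ell)}$; $\bar e_\ell:=\bar e_{\ell-1}-\bar s_\ell$. Put $X_{\le\ell}:=\bigcup_{j=\ell_0+1}^{\ell}\check X_j$. Adaptive steps with local cardinal functions (on the same selected sets $\check X_\ell=X_\ell\setminus\bar X_\ell$): $\check e_{\ell_0}:=e_{\ell_0}$ and, for $\ell_0<\ell\le L$, $\check s_\ell:=\sum_{x_i^{(\ell)}\in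 X_\ell\setminus\bar X_\ell}\check e_{\ell-1}(x_i^{(\ell)})\check\chi_i^{(\ell)}$, $\check e_\ell:=\check e_{\ell-1}-\check s_\ell$. *)

theory Defs
  imports "HOL-Analysis.Analysis" "HOL-Probability.Essential_Supremum"
begin

section \<open>Domain, kernel and norms\<close>

text \<open>Near each boundary point the set is the region strictly above the graph of a Lipschitz
  function over the hyperplane orthogonal to some unit vector \<open>e\<close>; \<open>x - (x \<bullet> e) *\<^sub>R e\<close> is the
  orthogonal projection of \<open>x\<close> onto that hyperplane.\<close>

definition lipschitz_boundary :: "(real^'d) set \<Rightarrow> bool" where
  "lipschitz_boundary \<Omega> \<longleftrightarrow>
     (\<forall>p \<in> frontier \<Omega>. \<exists>e g M r. norm e = 1 \<and> r > 0 \<and> M-lipschitz_on {y. y \<bullet> e = 0} g \<and>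
        (\<forall>x \<in> ball p r.
           (x \<in> \<Omega> \<longleftrightarrow> g (x - (x \<bullet> e) *\<^sub>R e) < x \<bullet> e) \<and>
           (x \<in> frontier \<Omega> \<longleftrightarrow> g (x - (x \<bullet> e) *\<^sub>R e) = x \<bullet> e)))"

definition bounded_lipschitz_domain :: "(real^'d) set \<Rightarrow> bool" where
  "bounded_lipschitz_domain \<Omega> \<longleftrightarrow>
     open \<Omega> \<and> connected \<Omega> \<and> \<Omega> \<noteq> {} \<and> bounded \<Omega> \<and> lipschitz_boundary \<Omega>"

definition fourier :: "(real^'d \<Rightarrow> real) \<Rightarrow> real^'d \<Rightarrow> complex" where
  "fourier \<Phi> \<omega> = (2 * pi) powr (- real CARD('d) / 2) *\<^sub>R
     (LINT x|lborel. \<Phi> x *\<^sub>R cis (- (x \<bullet> \<omega>)))"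

text \<open>The Fourier transform of a real radial function is real, hence the real part below.
  Its decay makes it integrable, so the class of \<open>\<Phi>\<close> in \<open>L\<^sub>1\<close> has a continuous representative;
  continuity selects it, since \<open>\<Phi>\<close> is evaluated pointwise.\<close>

definition admissible_kernel :: "real \<Rightarrow> real \<Rightarrow> real \<Rightarrow> (real^'d \<Rightarrow> real) \<Rightarrow> bool" where
  "admissible_kernel \<tau> c\<Phi> C\<Phi> \<Phi> \<longleftrightarrow>
     \<tau> > real CARD('d) / 2 \<and> c\<Phi> > 0 \<and> C\<Phi> > 0 \<and>
     continuous_on UNIV \<Phi> \<and> integrable lborel \<Phi> \<and>
     (\<forall>x y. norm x = norm y \<longrightarrow> \<Phi> x = \<Phi> y) \<and>
     closure {x. \<Phi> x \<noteq> 0} \<subseteq> cball 0 1 \<and>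
     (\<forall>\<omega>. c\<Phi> * (1 + (norm \<omega>)\<^sup>2) powr (- \<tau>) \<le> Re (fourier \<Phi> \<omega>) \<and>
          Re (fourier \<Phi> \<omega>) \<le> C\<Phi> * (1 + (norm \<omega>)\<^sup>2) powr (- \<tau>))"

definition scaled :: "(real^'d \<Rightarrow> real) \<Rightarrow> real \<Rightarrow> real^'d \<Rightarrow> real" where
  "scaled \<Phi> \<delta> x = \<Phi> (x /\<^sub>R \<delta>) / \<delta> ^ CARD('d)"

text \<open>The \<open>L\<^sub>\<infinity>(\<Omega>)\<close> norm, valued in the extended reals so that unbounded or non-measurable
  functions have norm \<open>\<infinity>\<close>.\<close>

definition Linf_norm :: "(real^'d) set \<Rightarrow> (real^'d \<Rightarrow> real) \<Rightarrow> ereal" where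
  "Linf_norm \<Omega> g = esssup (restrict_space lborel \<Omega>) (\<lambda>x. ereal \<bar>g x\<bar>)"

definition linf_norm :: "'a set \<Rightarrow> ('a \<Rightarrow> real) \<Rightarrow> real" where
  "linf_norm Y g = (if Y = {} then 0 else (MAX y\<in>Y. \<bar>g y\<bar>))"


section \<open>Point sets and cardinal functions\<close>

definition fill_dist :: "(real^'d) set \<Rightarrow> (real^'d) set \<Rightarrow> real" where
  "fill_dist \<Omega> Y = (SUP x\<in>\<Omega>. MIN y\<in>Y. norm (x - y))"

definition sep_dist :: "(real^'d) set \<Rightarrow> real" where
  "sep_dist Y = (1 / 2) * Min {norm (x - y) |x y. x \<in> Y \<and> y \<in> Y \<and> x \<noteq> y}"

text \<open>Levels are numbered from 1, so \<open>X 0\<close> is never used; the number \<open>h\<^sub>0\<close> is \<open>h\<^sub>1 / \<mu>\<close>.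
  Two points per level are what makes the minimum defining the separation distance meaningful.\<close>

definition admissible_points ::
  "(real^'d) set \<Rightarrow> real \<Rightarrow> real \<Rightarrow> real \<Rightarrow> real \<Rightarrow> real \<Rightarrow> real \<Rightarrow> (nat \<Rightarrow> (real^'d) set) \<Rightarrow> nat \<Rightarrow> bool"
  where
  "admissible_points \<Omega> \<mu> ch cq cn \<gamma> \<nu> X L \<longleftrightarrow>
     (let h = (\<lambda>l. fill_dist \<Omega> (X l)); q = (\<lambda>l. sep_dist (X l)); h0 = h 1 / \<mu> in
      (\<forall>l\<ge>1. finite (X l) \<and> 2 \<le> card (X l) \<and> X l \<subseteq> \<Omega>) \<and>
      (\<forall>l. 1 \<le> l \<and> l < L \<longrightarrow> X l \<subseteq> X (l + 1)) \<and>
      (\<forall>l\<in>{1..L}.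
         ch * \<mu> * h l \<le> h (l + 1) \<and> h (l + 1) \<le> \<mu> * h l \<and>
         ch * \<mu> ^ l * h0 \<le> h l \<and> h l \<le> \<mu> ^ l * h0 \<and>
         q l \<le> h l \<and> h l \<le> cq * q l \<and>
         cn * \<mu> powr (- real (CARD('d) * l)) \<le> real (card (X l))) \<and>
      1 / h 1 \<le> \<nu> \<and> \<nu> \<le> \<gamma> / \<mu>)"

definition level_kernel ::
  "(real^'d \<Rightarrow> real) \<Rightarrow> real \<Rightarrow> (real^'d) set \<Rightarrow> (real^'d) set \<Rightarrow> real^'d \<Rightarrow> real^'d \<Rightarrow> real" where
  "level_kernel \<Phi> \<nu> \<Omega> Y x y = scaled \<Phi> (\<nu> * fill_dist \<Omega> Y) (x - y)"

definition kernel_span :: "('a \<Rightarrow> 'a \<Rightarrow> real) \<Rightarrow> 'a set \<Rightarrow> ('a \<Rightarrow> real) set" where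
  "kernel_span K Y = {g. \<exists>a. g = (\<lambda>z. \<Sum>y\<in>Y. a y * K z y)}"

definition cardinal_fun :: "('a \<Rightarrow> 'a \<Rightarrow> real) \<Rightarrow> 'a set \<Rightarrow> 'a \<Rightarrow> 'a \<Rightarrow> real" where
  "cardinal_fun K Y x =
     (THE g. g \<in> kernel_span K Y \<and> (\<forall>y\<in>Y. g y = (if y = x then 1 else 0)))"

definition log_radius :: "(real^'d) set \<Rightarrow> (real^'d) set \<Rightarrow> real \<Rightarrow> real" where
  "log_radius \<Omega> Y a = a * fill_dist \<Omega> Y * \<bar>ln (fill_dist \<Omega> Y)\<bar>"

definition chi ::
  "(real^'d \<Rightarrow> real) \<Rightarrow> real \<Rightarrow> (real^'d) set \<Rightarrow> (real^'d) set \<Rightarrow> real^'d \<Rightarrow> real^'d \<Rightarrow> real" where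
  "chi \<Phi> \<nu> \<Omega> Y x = cardinal_fun (level_kernel \<Phi> \<nu> \<Omega> Y) Y x"

definition local_chi ::
  "(real^'d \<Rightarrow> real) \<Rightarrow> real \<Rightarrow> (real^'d) set \<Rightarrow> real \<Rightarrow> (real^'d) set \<Rightarrow> real^'d \<Rightarrow> real^'d \<Rightarrow> real" where
  "local_chi \<Phi> \<nu> \<Omega> \<rho> Y x =
     cardinal_fun (level_kernel \<Phi> \<nu> \<Omega> Y) (Y \<inter> cball x (log_radius \<Omega> Y \<rho>)) x"

text \<open>\<open>B\<close> is the inverse of the matrix with entries \<open>K x y\<close>, rows and columns indexed by \<open>Y\<close>.\<close>

definition is_gram_inverse :: "('a \<Rightarrow> 'a \<Rightarrow> real) \<Rightarrow> 'a set \<Rightarrow> ('a \<Rightarrow> 'a \<Rightarrow> real) \<Rightarrow> bool" where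
  "is_gram_inverse K Y B \<longleftrightarrow>
     (\<forall>x\<in>Y. \<forall>z\<in>Y. (\<Sum>y\<in>Y. K x y * B y z) = (if x = z then 1 else 0) \<and>
                    (\<Sum>y\<in>Y. B x y * K y z) = (if x = z then 1 else 0))"

definition decay_bounds ::
  "(real^'d \<Rightarrow> real) \<Rightarrow> real \<Rightarrow> (real^'d) set \<Rightarrow> real \<Rightarrow> real \<Rightarrow> real \<Rightarrow> (nat \<Rightarrow> (real^'d) set) \<Rightarrow> nat \<Rightarrow> bool"
  where
  "decay_bounds \<Phi> \<nu> \<Omega> \<theta> cA c\<chi> X L \<longleftrightarrow>
     (\<forall>l\<in>{1..L}.
        (\<exists>B. is_gram_inverse (level_kernel \<Phi> \<nu> \<Omega> (X l)) (X l) B \<and>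
           (\<forall>x\<in>X l. \<forall>y\<in>X l. \<bar>B x y\<bar> \<le>
              cA * sep_dist (X l) ^ CARD('d) * exp (- \<theta> * norm (x - y) / sep_dist (X l)))) \<and>
        (\<forall>x\<in>X l. \<forall>y. \<bar>chi \<Phi> \<nu> \<Omega> (X l) x y\<bar> \<le>
              c\<chi> * exp (- \<theta> * norm (x - y) / sep_dist (X l))))"


section \<open>Multiscale iterations\<close>

definition expansion :: "('a \<Rightarrow> 'a \<Rightarrow> real) \<Rightarrow> 'a set \<Rightarrow> ('a \<Rightarrow> real) \<Rightarrow> 'a \<Rightarrow> real" where
  "expansion b S e = (\<lambda>y. \<Sum>x\<in>S. e x * b x y)"

primrec class_err ::
  "(real^'d \<Rightarrow> real) \<Rightarrow> real \<Rightarrow> (real^'d) set \<Rightarrow> (nat \<Rightarrow> (real^'d) set) \<Rightarrow> (real^'d \<Rightarrow> real) \<Rightarrow>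
     nat \<Rightarrow> real^'d \<Rightarrow> real" where
  "class_err \<Phi> \<nu> \<Omega> X f 0 = f"
| "class_err \<Phi> \<nu> \<Omega> X f (Suc n) =
     (\<lambda>y. class_err \<Phi> \<nu> \<Omega> X f n y
        - expansion (chi \<Phi> \<nu> \<Omega> (X (Suc n))) (X (Suc n)) (class_err \<Phi> \<nu> \<Omega> X f n) y)"

definition start_level :: "real \<Rightarrow> real \<Rightarrow> nat" where
  "start_level k \<mu> = nat \<lceil>k * \<mu> / (1 - k * \<mu>)\<rceil>"

text \<open>In the next two definitions \<open>Y\<close> is the current level, \<open>Z\<close> the finest one.\<close>

definition small_err_points ::
  "(real^'d) set \<Rightarrow> (real^'d) set \<Rightarrow> real \<Rightarrow> real \<Rightarrow> (real^'d \<Rightarrow> real) \<Rightarrow> (real^'d) set" where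
  "small_err_points Y Z r \<eta> e = {x \<in> Y. \<forall>z \<in> Z \<inter> cball x r. \<bar>e z\<bar> \<le> \<eta>}"

definition selected_points ::
  "(real^'d) set \<Rightarrow> (real^'d) set \<Rightarrow> real \<Rightarrow> real \<Rightarrow> (real^'d \<Rightarrow> real) \<Rightarrow> (real^'d) set" where
  "selected_points Y Z r \<eta> e = Y - (\<Union>x \<in> small_err_points Y Z r \<eta> e. Y \<inter> cball x r)"

text \<open>The adaptive iterations are started at the level \<open>start_level k \<mu>\<close>; their values at lower
  levels are irrelevant and set to the initial one.\<close>

primrec adapt_err ::
  "(real^'d \<Rightarrow> real) \<Rightarrow> real \<Rightarrow> (real^'d) set \<Rightarrow> (nat \<Rightarrow> (real^'d) set) \<Rightarrow> real \<Rightarrow> real \<Rightarrow> real \<Rightarrow>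
     (nat \<Rightarrow> real) \<Rightarrow> nat \<Rightarrow> (real^'d \<Rightarrow> real) \<Rightarrow> nat \<Rightarrow> real^'d \<Rightarrow> real" where
  "adapt_err \<Phi> \<nu> \<Omega> X k \<mu> \<kappa> \<epsilon> L f 0 = class_err \<Phi> \<nu> \<Omega> X f (start_level k \<mu>)"
| "adapt_err \<Phi> \<nu> \<Omega> X k \<mu> \<kappa> \<epsilon> L f (Suc n) =
     (if Suc n \<le> start_level k \<mu> then class_err \<Phi> \<nu> \<Omega> X f (start_level k \<mu>)
      else (\<lambda>y. adapt_err \<Phi> \<nu> \<Omega> X k \<mu> \<kappa> \<epsilon> L f n y
        - expansion (chi \<Phi> \<nu> \<Omega> (X (Suc n)))
            (selected_points (X (Suc n)) (X L) (log_radius \<Omega> (X (Suc n)) (k * \<kappa>)) (\<epsilon> n)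
               (adapt_err \<Phi> \<nu> \<Omega> X k \<mu> \<kappa> \<epsilon> L f n))
            (adapt_err \<Phi> \<nu> \<Omega> X k \<mu> \<kappa> \<epsilon> L f n) y))"

definition adapt_points ::
  "(real^'d \<Rightarrow> real) \<Rightarrow> real \<Rightarrow> (real^'d) set \<Rightarrow> (nat \<Rightarrow> (real^'d) set) \<Rightarrow> real \<Rightarrow> real \<Rightarrow> real \<Rightarrow>
     (nat \<Rightarrow> real) \<Rightarrow> nat \<Rightarrow> (real^'d \<Rightarrow> real) \<Rightarrow> nat \<Rightarrow> (real^'d) set" where
  "adapt_points \<Phi> \<nu> \<Omega> X k \<mu> \<kappa> \<epsilon> L f l =
     selected_points (X l) (X L) (log_radius \<Omega> (X l) (k * \<kappa>)) (\<epsilon> (l - 1))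
       (adapt_err \<Phi> \<nu> \<Omega> X k \<mu> \<kappa> \<epsilon> L f (l - 1))"

definition adapt_points_upto ::
  "(real^'d \<Rightarrow> real) \<Rightarrow> real \<Rightarrow> (real^'d) set \<Rightarrow> (nat \<Rightarrow> (real^'d) set) \<Rightarrow> real \<Rightarrow> real \<Rightarrow> real \<Rightarrow>
     (nat \<Rightarrow> real) \<Rightarrow> nat \<Rightarrow> (real^'d \<Rightarrow> real) \<Rightarrow> nat \<Rightarrow> (real^'d) set" where
  "adapt_points_upto \<Phi> \<nu> \<Omega> X k \<mu> \<kappa> \<epsilon> L f l =
     (\<Union>j \<in> {start_level k \<mu> + 1..l}. adapt_points \<Phi> \<nu> \<Omega> X k \<mu> \<kappa> \<epsilon> L f j)"

definition adapt_step ::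
  "(real^'d \<Rightarrow> real) \<Rightarrow> real \<Rightarrow> (real^'d) set \<Rightarrow> (nat \<Rightarrow> (real^'d) set) \<Rightarrow> real \<Rightarrow> real \<Rightarrow> real \<Rightarrow>
     (nat \<Rightarrow> real) \<Rightarrow> nat \<Rightarrow> (real^'d \<Rightarrow> real) \<Rightarrow> nat \<Rightarrow> real^'d \<Rightarrow> real" where
  "adapt_step \<Phi> \<nu> \<Omega> X k \<mu> \<kappa> \<epsilon> L f l =
     expansion (chi \<Phi> \<nu> \<Omega> (X l)) (adapt_points \<Phi> \<nu> \<Omega> X k \<mu> \<kappa> \<epsilon> L f l)
       (adapt_err \<Phi> \<nu> \<Omega> X k \<mu> \<kappa> \<epsilon> L f (l - 1))"

text \<open>The local variant reuses the points selected by the iteration above, not its own.\<close>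

primrec local_err ::
  "(real^'d \<Rightarrow> real) \<Rightarrow> real \<Rightarrow> (real^'d) set \<Rightarrow> (nat \<Rightarrow> (real^'d) set) \<Rightarrow> real \<Rightarrow> real \<Rightarrow> real \<Rightarrow> real \<Rightarrow>
     (nat \<Rightarrow> real) \<Rightarrow> nat \<Rightarrow> (real^'d \<Rightarrow> real) \<Rightarrow> nat \<Rightarrow> real^'d \<Rightarrow> real" where
  "local_err \<Phi> \<nu> \<Omega> X k \<mu> \<kappa> \<rho> \<epsilon> L f 0 = class_err \<Phi> \<nu> \<Omega> X f (start_level k \<mu>)"
| "local_err \<Phi> \<nu> \<Omega> X k \<mu> \<kappa> \<rho> \<epsilon> L f (Suc n) =
     (if Suc n \<le> start_level k \<mu> then class_err \<Phi> \<nu> \<Omega> X f (start_level k \<mu>)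
      else (\<lambda>y. local_err \<Phi> \<nu> \<Omega> X k \<mu> \<kappa> \<rho> \<epsilon> L f n y
        - expansion (local_chi \<Phi> \<nu> \<Omega> \<rho> (X (Suc n)))
            (adapt_points \<Phi> \<nu> \<Omega> X k \<mu> \<kappa> \<epsilon> L f (Suc n))
            (local_err \<Phi> \<nu> \<Omega> X k \<mu> \<kappa> \<rho> \<epsilon> L f n) y))"

definition local_step ::
  "(real^'d \<Rightarrow> real) \<Rightarrow> real \<Rightarrow> (real^'d) set \<Rightarrow> (nat \<Rightarrow> (real^'d) set) \<Rightarrow> real \<Rightarrow> real \<Rightarrow> real \<Rightarrow> real \<Rightarrow>
     (nat \<Rightarrow> real) \<Rightarrow> nat \<Rightarrow> (real^'d \<Rightarrow> real) \<Rightarrow> nat \<Rightarrow> real^'d \<Rightarrow> real" where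
  "local_step \<Phi> \<nu> \<Omega> X k \<mu> \<kappa> \<rho> \<epsilon> L f l =
     expansion (local_chi \<Phi> \<nu> \<Omega> \<rho> (X l)) (adapt_points \<Phi> \<nu> \<Omega> X k \<mu> \<kappa> \<epsilon> L f l)
       (local_err \<Phi> \<nu> \<Omega> X k \<mu> \<kappa> \<rho> \<epsilon> L f (l - 1))"

end

theory Submission
  imports Defs "HOL-Probability.Characteristic_Functions"
begin

text \<open>
  Both iterations sample on the same point sets, so the difference of two corresponding steps is
  \<open>\<Sum> e(x) (\<chi>\<^sub>x - \<chi>'\<^sub>x) + \<Sum> (e - e')(x) \<chi>'\<^sub>x\<close>, where \<open>e\<close>, \<open>e'\<close> are the current errors of the two
  iterations, \<open>\<chi>\<^sub>x\<close> is a cardinal function and \<open>\<chi>'\<^sub>x\<close> its local version. At the sampling points \<open>e\<close>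
  grows at most by the factor \<open>1 + \<Lambda>\<close> per level, and there are at most \<open>Cn * h powr (- d)\<close> of them;
  this bounds the first sum by means of the localization error \<open>\<chi>\<^sub>x - \<chi>'\<^sub>x\<close>. The second
  sum is at most \<open>\<Lambda>\<close> times the previous difference, as soon as \<open>\<Lambda>\<close> bounds the Lebesgue constants of
  the full \<^emph>\<open>and\<close> of the local cardinal functions. Solving the resulting recursion
  (\<open>perturbed_iteration.error_difference\<close>) leaves a sum of powers \<open>h\<^sub>j powr a\<close> with \<open>a > 0\<close>, which is
  dominated by a geometric series.

  Two estimates on a single level feed this argument; both use only quadratic forms.

  \<^item> \<^emph>\<open>Localization\<close> (\<open>cardinal_level.chi_localization\<close>). The difference \<open>v = \<chi>'\<^sub>x - \<chi>\<^sub>x\<close> lies in the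
    span of the kernel translates, vanishes at the points of the ball \<open>P\<close> that defines \<open>\<chi>'\<^sub>x\<close>, and its
    coefficients off \<open>P\<close> are those of \<open>- \<chi>\<^sub>x\<close>, that is, entries of the inverse Gram matrix far from
    the diagonal. In the energy of \<open>v\<close>, the sum of coefficient times value, only the points off \<open>P\<close>
    survive, and this energy controls the values of \<open>v\<close>.
  \<^item> \<^emph>\<open>Uniform Lebesgue constants of the local functions\<close> (\<open>cardinal_level.cardinal_fun_decay\<close>). The
    decay rate \<open>\<theta>\<close> is known for the inverse of the full Gram matrix only. But each principal submatrix
    has a condition number bounded uniformly in the level and couples only points within distance
    \<open>\<nu> * h\<close>. Conjugating it with an exponential weight of small enough rate perturbs it by less than
    half of its lower bound, so the conjugated inverse stays bounded: the Combes-Thomas argument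
    (\<open>combes_thomas\<close>). This gives exponential decay with a smaller rate, which suffices to sum up.

  The positivity needed throughout comes from the Fourier transform. The convolution of \<open>\<Phi>\<close> with a
  narrow Gaussian is an integral of nonnegative multiples of characters, so it has nonnegative
  quadratic forms, and these pass to the limit \<open>\<Phi>\<close> (\<open>continuous_psd_of_nonneg_fourier\<close>). Together
  with the bound on the inverse of the Gram matrix they become coercive, which also makes all local
  interpolation problems uniquely solvable.
\<close>


section \<open>Quadratic forms of kernels on finite sets\<close>

definition bilin :: "('a \<Rightarrow> 'a \<Rightarrow> real) \<Rightarrow> 'a set \<Rightarrow> ('a \<Rightarrow> real) \<Rightarrow> ('a \<Rightarrow> real) \<Rightarrow> real" where
  "bilin K Y u v = (\<Sum>x\<in>Y. \<Sum>y\<in>Y. u x * K x y * v y)"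

definition kernel_comb :: "('a \<Rightarrow> 'a \<Rightarrow> real) \<Rightarrow> 'a set \<Rightarrow> ('a \<Rightarrow> real) \<Rightarrow> 'a \<Rightarrow> real" where
  "kernel_comb K Y w = (\<lambda>z. \<Sum>y\<in>Y. w y * K z y)"

lemma bilin_kernel_comb: "bilin K Y u v = (\<Sum>x\<in>Y. u x * kernel_comb K Y v x)"
  by (simp add: bilin_def kernel_comb_def sum_distrib_left mult_ac)

lemma kernel_comb_diff:
  "kernel_comb K Y (\<lambda>y. u y - c * v y) z = kernel_comb K Y u z - c * kernel_comb K Y v z"
  by (simp add: kernel_comb_def sum_subtractf sum_distrib_left algebra_simps)

lemma bilin_commute:
  assumes "\<And>x y. x \<in> Y \<Longrightarrow> y \<in> Y \<Longrightarrow> K x y = K y x"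
  shows "bilin K Y u v = bilin K Y v u"
proof -
  have "bilin K Y u v = (\<Sum>y\<in>Y. \<Sum>x\<in>Y. u x * K x y * v y)"
    unfolding bilin_def by (rule sum.swap)
  also have "\<dots> = bilin K Y v u"
    unfolding bilin_def by (intro sum.cong refl) (simp add: assms mult_ac)
  finally show ?thesis .
qed

lemma schur_test:
  assumes rows: "\<And>x. x \<in> Y \<Longrightarrow> (\<Sum>y\<in>Y. \<bar>E x y\<bar>) \<le> \<beta>"
    and cols: "\<And>y. y \<in> Y \<Longrightarrow> (\<Sum>x\<in>Y. \<bar>E x y\<bar>) \<le> \<beta>"
  shows "\<bar>bilin E Y u v\<bar> \<le> \<beta> / 2 * ((\<Sum>x\<in>Y. (u x)\<^sup>2) + (\<Sum>x\<in>Y. (v x)\<^sup>2))"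
proof -
  have amgm: "\<bar>u x * E x y * v y\<bar> \<le> \<bar>E x y\<bar> * (u x)\<^sup>2 / 2 + \<bar>E x y\<bar> * (v y)\<^sup>2 / 2" for x y
  proof -
    have "2 * \<bar>u x * v y\<bar> \<le> (u x)\<^sup>2 + (v y)\<^sup>2"
      using sum_squares_bound[of "\<bar>u x\<bar>" "\<bar>v y\<bar>"] by (simp add: abs_mult)
    then have "\<bar>E x y\<bar> * (2 * \<bar>u x * v y\<bar>) \<le> \<bar>E x y\<bar> * ((u x)\<^sup>2 + (v y)\<^sup>2)"
      by (rule mult_left_mono) simp
    then show ?thesis by (simp add: abs_mult algebra_simps)
  qed
  have "\<bar>bilin E Y u v\<bar> \<le> (\<Sum>x\<in>Y. \<Sum>y\<in>Y. \<bar>u x * E x y * v y\<bar>)"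
    unfolding bilin_def by (intro order.trans[OF sum_abs] sum_mono sum_abs)
  also have "\<dots> \<le> (\<Sum>x\<in>Y. \<Sum>y\<in>Y. \<bar>E x y\<bar> * (u x)\<^sup>2 / 2 + \<bar>E x y\<bar> * (v y)\<^sup>2 / 2)"
    by (intro sum_mono amgm)
  also have "\<dots> = (\<Sum>x\<in>Y. (\<Sum>y\<in>Y. \<bar>E x y\<bar>) * ((u x)\<^sup>2 / 2))
      + (\<Sum>x\<in>Y. \<Sum>y\<in>Y. \<bar>E x y\<bar> * (v y)\<^sup>2 / 2)"
    by (simp add: sum.distrib sum_distrib_right sum_divide_distrib)
  also have "(\<Sum>x\<in>Y. \<Sum>y\<in>Y. \<bar>E x y\<bar> * (v y)\<^sup>2 / 2)
      = (\<Sum>y\<in>Y. (\<Sum>x\<in>Y. \<bar>E x y\<bar>) * ((v y)\<^sup>2 / 2))"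
    by (subst sum.swap) (simp add: sum_distrib_right sum_divide_distrib)
  also have "(\<Sum>x\<in>Y. (\<Sum>y\<in>Y. \<bar>E x y\<bar>) * ((u x)\<^sup>2 / 2)) \<le> (\<Sum>x\<in>Y. \<beta> * ((u x)\<^sup>2 / 2))"
    by (intro sum_mono mult_right_mono rows) auto
  also have "(\<Sum>y\<in>Y. (\<Sum>x\<in>Y. \<bar>E x y\<bar>) * ((v y)\<^sup>2 / 2)) \<le> (\<Sum>x\<in>Y. \<beta> * ((v x)\<^sup>2 / 2))"
    by (intro sum_mono mult_right_mono cols) auto
  finally show ?thesis
    by (simp add: sum_distrib_left sum_divide_distrib distrib_left)
qed

text \<open>For a symmetric positive semidefinite matrix of norm at most \<open>M\<close> this is \<open>K\<^sup>2 \<le> M K\<close>. It follows by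
  expanding the nonnegative quadratic form at \<open>w - (1 / M) K w\<close>.\<close>

lemma norm_image_le_quadratic_form:
  assumes sym: "\<And>x y. x \<in> Y \<Longrightarrow> y \<in> Y \<Longrightarrow> K x y = K y x"
    and psd: "\<And>w. 0 \<le> bilin K Y w w"
    and rows: "\<And>x. x \<in> Y \<Longrightarrow> (\<Sum>y\<in>Y. \<bar>K x y\<bar>) \<le> M" and M: "M > 0"
  shows "(\<Sum>x\<in>Y. (kernel_comb K Y w x)\<^sup>2) \<le> M * bilin K Y w w"
proof -
  define v where "v = kernel_comb K Y w"
  let ?V = "\<Sum>x\<in>Y. (v x)\<^sup>2"
  have cols: "(\<Sum>x\<in>Y. \<bar>K x y\<bar>) \<le> M" if "y \<in> Y" for y
    using rows[OF that] sum.cong[OF refl, of Y "\<lambda>x. \<bar>K y x\<bar>" "\<lambda>x. \<bar>K x y\<bar>"] sym that by simp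
  have vv: "bilin K Y v v \<le> M * ?V"
    using schur_test[of Y K M v v, OF rows cols] by simp
  have vw: "bilin K Y v w = ?V"
    unfolding bilin_kernel_comb by (simp add: v_def power2_eq_square)
  then have wv: "bilin K Y w v = ?V"
    using bilin_commute[of Y K w v, OF sym] by simp
  have "0 \<le> bilin K Y (\<lambda>x. w x - (1/M) * v x) (\<lambda>x. w x - (1/M) * v x)"
    by (rule psd)
  also have "\<dots> = bilin K Y w w - (1/M) * bilin K Y w v - (1/M) * bilin K Y v w
      + (1/M) * (1/M) * bilin K Y v v"
    unfolding bilin_kernel_comb kernel_comb_diff sum_distrib_left sum_subtractf[symmetric]
      sum.distrib[symmetric]
    by (intro sum.cong refl) (simp add: algebra_simps diff_divide_distrib)
  also have "\<dots> \<le> bilin K Y w w - (1/M) * ?V - (1/M) * ?V + (1/M) * (1/M) * (M * ?V)"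
    using vv M unfolding vw wv
    by (intro add_mono diff_mono order.refl mult_left_mono) auto
  also have "\<dots> = bilin K Y w w - ?V / M"
    using M by (simp add: field_simps)
  finally show ?thesis
    using M unfolding v_def by (simp add: field_simps)
qed

text \<open>The lower bound is the reciprocal of \<open>\<beta>\<^sup>2 M\<close>, as \<open>|w| = |B K w| \<le> \<beta> |K w|\<close> and \<open>|K w|\<^sup>2\<close> is at most \<open>M\<close>
  times the quadratic form. Unlike a bound on the inverse, a lower bound for the form is inherited by
  all principal submatrices.\<close>

lemma quadratic_form_coercive:
  assumes fin: "finite Y"
    and sym: "\<And>x y. x \<in> Y \<Longrightarrow> y \<in> Y \<Longrightarrow> K x y = K y x"
    and psd: "\<And>w. 0 \<le> bilin K Y w w"
    and rows: "\<And>x. x \<in> Y \<Longrightarrow> (\<Sum>y\<in>Y. \<bar>K x y\<bar>) \<le> M" and M: "M > 0"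
    and inv: "is_gram_inverse K Y B"
    and Brows: "\<And>x. x \<in> Y \<Longrightarrow> (\<Sum>y\<in>Y. \<bar>B x y\<bar>) \<le> \<beta>"
    and Bcols: "\<And>y. y \<in> Y \<Longrightarrow> (\<Sum>x\<in>Y. \<bar>B x y\<bar>) \<le> \<beta>" and \<beta>: "\<beta> > 0"
  shows "(\<Sum>x\<in>Y. (w x)\<^sup>2) \<le> \<beta>\<^sup>2 * M * bilin K Y w w"
proof -
  define v where "v = kernel_comb K Y w"
  let ?W = "\<Sum>x\<in>Y. (w x)\<^sup>2" and ?V = "\<Sum>x\<in>Y. (v x)\<^sup>2"
  have Bv: "(\<Sum>y\<in>Y. B x y * v y) = w x" if x: "x \<in> Y" for x
  proof -
    have "(\<Sum>y\<in>Y. B x y * v y) = (\<Sum>y\<in>Y. \<Sum>z\<in>Y. (B x y * K y z) * w z)"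
      by (simp add: v_def kernel_comb_def sum_distrib_left mult_ac)
    also have "\<dots> = (\<Sum>z\<in>Y. (\<Sum>y\<in>Y. B x y * K y z) * w z)"
      by (subst sum.swap) (simp add: sum_distrib_right)
    also have "\<dots> = (\<Sum>z\<in>Y. (if x = z then 1 else 0) * w z)"
      using inv x unfolding is_gram_inverse_def by (intro sum.cong refl) simp
    also have "\<dots> = w x"
      using fin x by (simp add: if_distrib[where f="\<lambda>c. c * _"] cong: if_cong)
    finally show ?thesis .
  qed
  have "?W * \<beta> = bilin B Y w (\<lambda>y. \<beta> * v y)"
  proof -
    have "bilin B Y w (\<lambda>y. \<beta> * v y) = (\<Sum>x\<in>Y. w x * \<beta> * (\<Sum>y\<in>Y. B x y * v y))"
      by (simp add: bilin_def sum_distrib_left mult_ac)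
    also have "\<dots> = (\<Sum>x\<in>Y. w x * \<beta> * w x)"
      by (intro sum.cong refl) (simp only: Bv)
    finally show ?thesis
      by (simp add: sum_distrib_left power2_eq_square mult_ac)
  qed
  also have "\<dots> \<le> \<beta> / 2 * (?W + (\<Sum>x\<in>Y. (\<beta> * v x)\<^sup>2))"
    using schur_test[of Y B \<beta> w "\<lambda>y. \<beta> * v y", OF Brows Bcols] by simp
  finally have "?W \<le> (\<Sum>x\<in>Y. (\<beta> * v x)\<^sup>2)"
    using \<beta> by (simp add: field_simps)
  also have "\<dots> = \<beta>\<^sup>2 * ?V"
    by (simp add: power_mult_distrib sum_distrib_left)
  also have "\<dots> \<le> \<beta>\<^sup>2 * (M * bilin K Y w w)"
    unfolding v_def
    by (intro mult_left_mono norm_image_le_quadratic_form sym psd rows M) auto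
  finally show ?thesis by (simp add: mult.assoc)
qed

lemma bilin_extend_zero:
  assumes "finite Y" and "P \<subseteq> Y"
  shows "bilin K P u v = bilin K Y (\<lambda>x. if x \<in> P then u x else 0) (\<lambda>x. if x \<in> P then v x else 0)"
proof -
  have "bilin K Y (\<lambda>x. if x \<in> P then u x else 0) (\<lambda>x. if x \<in> P then v x else 0)
      = (\<Sum>x\<in>Y. if x \<in> P then (\<Sum>y\<in>Y. if y \<in> P then u x * K x y * v y else 0) else 0)"
    unfolding bilin_def by (auto intro!: sum.cong)
  also have "\<dots> = bilin K P u v"
    using assms unfolding bilin_def
    by (simp add: sum.inter_restrict[symmetric] Int_absorb1)
  finally show ?thesis by simp
qed

lemma quadratic_form_coercive_subset:
  assumes "finite Y" and "P \<subseteq> Y" and "\<And>w. (\<Sum>x\<in>Y. (w x)\<^sup>2) \<le> C * bilin K Y w w"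
  shows "(\<Sum>x\<in>P. (w x)\<^sup>2) \<le> C * bilin K P w w"
proof -
  have "(\<Sum>x\<in>P. (w x)\<^sup>2) = (\<Sum>x\<in>Y. (if x \<in> P then w x else 0)\<^sup>2)"
    using assms(1,2)
    by (simp add: if_distrib[where f="\<lambda>c. c\<^sup>2"] sum.inter_restrict[symmetric] Int_absorb1 cong: if_cong)
  then show ?thesis
    using assms(3) bilin_extend_zero[OF assms(1,2), of K w w] by simp
qed

text \<open>Gaussian elimination, one point at a time; coercivity makes the pivots nonzero.\<close>

lemma kernel_system_solvable:
  assumes "finite P"
    and sym: "\<And>x y. x \<in> P \<Longrightarrow> y \<in> P \<Longrightarrow> K x y = K y x"
    and pd: "\<And>w. (\<Sum>x\<in>P. (w x)\<^sup>2) \<le> C * bilin K P w w"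
  shows "\<exists>b. \<forall>x\<in>P. kernel_comb K P b x = r x"
  using assms
proof (induction P arbitrary: r)
  case empty
  then show ?case by simp
next
  case (insert p P)
  have pd': "(\<Sum>x\<in>P. (w x)\<^sup>2) \<le> C * bilin K P w w" for w
    by (rule quadratic_form_coercive_subset[OF _ _ insert.prems(2)]) (use insert in auto)
  note IH = insert.IH[OF insert.prems(1) pd']
  obtain b1 where b1: "\<And>x. x \<in> P \<Longrightarrow> kernel_comb K P b1 x = r x"
    using IH[of r] by auto
  obtain b2 where b2: "\<And>x. x \<in> P \<Longrightarrow> kernel_comb K P b2 x = K x p"
    using IH[of "\<lambda>x. K x p"] by auto
  \<comment> \<open>The Schur complement of the new diagonal entry: the value of the quadratic form at
    \<open>w\<close> below, hence nonzero.\<close>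
  define s where "s = K p p - kernel_comb K P b2 p"
  define w where "w = (\<lambda>x. if x = p then 1 else - b2 x)"
  have ext: "kernel_comb K (insert p P) (\<lambda>x. if x = p then t else b x) z
      = t * K z p + kernel_comb K P b z" for t b z
  proof -
    have "(\<Sum>y\<in>P. (if y = p then t else b y) * K z y) = (\<Sum>y\<in>P. b y * K z y)"
      using insert.hyps by (intro sum.cong) auto
    then show ?thesis using insert.hyps by (simp add: kernel_comb_def)
  qed
  have neg: "kernel_comb K P (\<lambda>x. - b2 x) z = - kernel_comb K P b2 z" for z
    by (simp add: kernel_comb_def sum_negf)
  have "bilin K (insert p P) w w = s"
    unfolding bilin_kernel_comb w_def ext neg using insert.hyps b2
    by (simp add: s_def)
  moreover have "(\<Sum>x\<in>insert p P. (w x)\<^sup>2) > 0"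
    using insert.hyps by (intro sum_pos2[where i = p]) (auto simp: w_def)
  ultimately have "s \<noteq> 0"
    using insert.prems(2)[of w] by auto
  define t where "t = (r p - kernel_comb K P b1 p) / s"
  define b where "b = (\<lambda>x. if x = p then t else b1 x - t * b2 x)"
  have "kernel_comb K (insert p P) b x = r x" if "x \<in> insert p P" for x
  proof (cases "x = p")
    case True
    have "t * s = r p - kernel_comb K P b1 p"
      using \<open>s \<noteq> 0\<close> by (simp add: t_def)
    then show ?thesis
      unfolding b_def ext kernel_comb_diff True by (simp add: s_def algebra_simps)
  next
    case False
    then show ?thesis
      using that b1 b2 unfolding b_def ext kernel_comb_diff by simp
  qed
  then show ?case by blast
qed

lemma cardinal_fun_eq_kernel_comb:
  assumes "finite P"
    and pd: "\<And>w. (\<Sum>x\<in>P. (w x)\<^sup>2) \<le> C * bilin K P w w"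
    and b: "\<And>y. y \<in> P \<Longrightarrow> kernel_comb K P b y = (if y = x then 1 else 0)"
  shows "cardinal_fun K P x = kernel_comb K P b"
  unfolding cardinal_fun_def
proof (rule the_equality)
  show "kernel_comb K P b \<in> kernel_span K P \<and>
      (\<forall>y\<in>P. kernel_comb K P b y = (if y = x then 1 else 0))"
    using b by (auto simp: kernel_span_def kernel_comb_def)
next
  fix g assume g: "g \<in> kernel_span K P \<and> (\<forall>y\<in>P. g y = (if y = x then 1 else 0))"
  then obtain a where a: "g = kernel_comb K P a"
    by (auto simp: kernel_span_def kernel_comb_def)
  have "bilin K P (\<lambda>y. a y - 1 * b y) (\<lambda>y. a y - 1 * b y) = 0"
    unfolding bilin_kernel_comb kernel_comb_diff using g a b by simp
  then have "(\<Sum>y\<in>P. (a y - b y)\<^sup>2) \<le> 0"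
    using pd[of "\<lambda>y. a y - 1 * b y"] by simp
  then have "(\<Sum>y\<in>P. (a y - b y)\<^sup>2) = 0"
    by (intro antisym sum_nonneg) auto
  then have "\<forall>y\<in>P. (a y - b y)\<^sup>2 = 0"
    using \<open>finite P\<close> by (subst (asm) sum_nonneg_eq_0_iff) auto
  then show "g = kernel_comb K P b"
    by (simp add: a kernel_comb_def)
qed

text \<open>Conjugating the matrix with the weight \<open>exp \<phi>\<close> adds the perturbation \<open>K x y * (exp (\<phi> x - \<phi> y) - 1)\<close>,
  whose norm is at most half of the lower bound \<open>lam\<close> by the Schur test. The weighted coefficients
  \<open>exp (\<phi> x) * b x\<close> solve the conjugated system with the same right-hand side, a unit vector, so their
  norm is at most \<open>2 / lam\<close>.\<close>

lemma combes_thomas: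
  assumes fin: "finite P" and p: "p \<in> P"
    and pd: "\<And>w. lam * (\<Sum>x\<in>P. (w x)\<^sup>2) \<le> bilin K P w w" and lam: "lam > 0"
    and b: "\<And>x. x \<in> P \<Longrightarrow> kernel_comb K P b x = (if x = p then 1 else 0)"
    and rows: "\<And>x. x \<in> P \<Longrightarrow> (\<Sum>y\<in>P. \<bar>K x y * (exp (\<phi> x - \<phi> y) - 1)\<bar>) \<le> lam / 2"
    and cols: "\<And>y. y \<in> P \<Longrightarrow> (\<Sum>x\<in>P. \<bar>K x y * (exp (\<phi> x - \<phi> y) - 1)\<bar>) \<le> lam / 2"
    and \<phi>: "\<phi> p = 0" and x: "x \<in> P"
  shows "\<bar>b x\<bar> \<le> 2 / lam * exp (- \<phi> x)"
proof -
  define v where "v = (\<lambda>x. exp (\<phi> x) * b x)"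
  define E where "E = (\<lambda>x y. K x y * (exp (\<phi> x - \<phi> y) - 1))"
  let ?V = "\<Sum>x\<in>P. (v x)\<^sup>2"
  have vle: "(v y)\<^sup>2 \<le> ?V" if "y \<in> P" for y
    using fin that by (intro member_le_sum) auto
  have "bilin K P v v + bilin E P v v = (\<Sum>x\<in>P. v x * exp (\<phi> x) * kernel_comb K P b x)"
    unfolding bilin_def kernel_comb_def sum.distrib[symmetric] sum_distrib_left
    by (intro sum.cong refl) (simp add: E_def v_def algebra_simps exp_diff)
  also have "\<dots> = (\<Sum>x\<in>P. if x = p then v p else 0)"
    by (intro sum.cong refl) (simp add: b \<phi>)
  also have "\<dots> = v p"
    using fin p by simp
  finally have "bilin K P v v + bilin E P v v = v p" .
  moreover have "\<bar>bilin E P v v\<bar> \<le> lam / 2 * ?V"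
    using schur_test[of P E "lam / 2" v v] rows cols by (simp add: E_def)
  moreover have "lam * ?V \<le> bilin K P v v"
    by (rule pd)
  ultimately have le: "lam / 2 * ?V \<le> v p"
    by (simp add: abs_le_iff)
  define s where "s = sqrt ?V"
  have s: "s\<^sup>2 = ?V" "s \<ge> 0"
    by (auto simp: s_def sum_nonneg)
  have vs: "\<bar>v y\<bar> \<le> s" if "y \<in> P" for y
    using vle[OF that] unfolding s_def by (metis real_sqrt_abs real_sqrt_le_iff)
  have "lam / 2 * s * s \<le> 1 * s"
    using le vs[OF p] s by (simp add: power2_eq_square mult.assoc)
  then have "lam / 2 * s \<le> 1"
    using s lam by (cases "s = 0") (auto dest: mult_right_le_imp_le)
  then have "\<bar>v x\<bar> \<le> 2 / lam"
    using order.trans[OF mult_left_mono[OF vs[OF x], of "lam / 2"], of 1] lam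
    by (simp add: field_simps)
  then have "\<bar>b x\<bar> * exp (\<phi> x) \<le> 2 / lam"
    by (simp add: v_def abs_mult mult_ac)
  then have "\<bar>b x\<bar> \<le> 2 / lam / exp (\<phi> x)"
    by (subst pos_le_divide_eq) auto
  then show ?thesis
    by (simp add: exp_minus divide_inverse)
qed


section \<open>Positive semidefinite kernels and the Fourier transform\<close>

lemma
  fixes f :: "'a::euclidean_space \<Rightarrow> real \<Rightarrow> complex"
  assumes f: "\<And>b. b \<in> Basis \<Longrightarrow> integrable lborel (f b)"
  shows integrable_lborel_prod_Basis: "integrable lborel (\<lambda>x::'a. \<Prod>b\<in>Basis. f b (x \<bullet> b))"
    and integral_lborel_prod_Basis:
      "(LINT x|lborel. (\<Prod>b\<in>Basis. f b (x \<bullet> b))) = (\<Prod>b\<in>Basis. (LINT s|lborel. f b s))"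
proof -
  interpret product_sigma_finite "\<lambda>_::'a. lborel::real measure" ..
  let ?T = "\<lambda>g. \<Sum>b\<in>Basis. g b *\<^sub>R (b::'a)"
  let ?P = "\<Pi>\<^sub>M b\<in>(Basis::'a set). (lborel::real measure)"
  have T: "?T \<in> ?P \<rightarrow>\<^sub>M borel"
    by measurable
  have m: "(\<lambda>x::'a. \<Prod>b\<in>Basis. f b (x \<bullet> b)) \<in> borel_measurable borel"
  proof (rule borel_measurable_prod)
    fix b :: 'a assume "b \<in> Basis"
    then have [measurable]: "f b \<in> borel_measurable borel"
      using borel_measurable_integrable[OF f] by simp
    show "(\<lambda>x. f b (x \<bullet> b)) \<in> borel_measurable borel" by measurable
  qed
  have eq: "(\<Prod>b\<in>Basis. f b (?T g \<bullet> b)) = (\<Prod>b\<in>Basis. f b (g b))" for g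
    by (intro prod.cong refl) simp
  show "integrable lborel (\<lambda>x::'a. \<Prod>b\<in>Basis. f b (x \<bullet> b))"
    unfolding lborel_eq[where 'a='a] integrable_distr_eq[OF T m] eq
    by (rule product_integrable_prod) (auto intro: f)
  show "(LINT x|lborel. (\<Prod>b\<in>Basis. f b (x \<bullet> b))) = (\<Prod>b\<in>Basis. (LINT s|lborel. f b s))"
    unfolding lborel_eq[where 'a='a] integral_distr[OF T m] eq
    by (rule product_integral_prod) (auto intro: f)
qed

lemma
  shows integrable_gaussian_cis: "integrable lborel (\<lambda>s. cis (t * s) * exp (- s\<^sup>2 / 2))"
    and integral_gaussian_cis:
      "(LINT s|lborel. cis (t * s) * exp (- s\<^sup>2 / 2)) = sqrt (2 * pi) * exp (- t\<^sup>2 / 2)"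
proof -
  have eq: "cis (t * s) * exp (- s\<^sup>2 / 2) = sqrt (2 * pi) *\<^sub>R (std_normal_density s *\<^sub>R iexp (t * s))" for s
    by (simp add: std_normal_density_def cis_conv_exp scaleR_conv_of_real)
  have "integrable lborel (\<lambda>s. std_normal_density s *\<^sub>R iexp (t * s))"
  proof (rule Bochner_Integration.integrable_bound)
    show "integrable lborel std_normal_density"
      by (rule integrable_normal_density) simp
  qed (auto simp: std_normal_density_def)
  then show "integrable lborel (\<lambda>s. cis (t * s) * exp (- s\<^sup>2 / 2))"
    unfolding eq by (rule integrable_scaleR_right)
  have "(LINT s|lborel. std_normal_density s *\<^sub>R iexp (t * s)) = exp (- t\<^sup>2 / 2)"
    using char_std_normal_distribution[THEN fun_cong, of t]
    unfolding char_def by (subst (asm) integral_density) (auto simp: std_normal_density_def)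
  then show "(LINT s|lborel. cis (t * s) * exp (- s\<^sup>2 / 2)) = sqrt (2 * pi) * exp (- t\<^sup>2 / 2)"
    unfolding eq by (simp add: scaleR_conv_of_real)
qed

definition gauss :: "'a::euclidean_space \<Rightarrow> real" where
  "gauss x = exp (- (norm x)\<^sup>2 / 2)"

lemma gauss_pos: "gauss x > 0" by (simp add: gauss_def)

lemma continuous_on_gauss: "continuous_on UNIV gauss"
  unfolding gauss_def by (intro continuous_intros) auto

lemma gauss_measurable[measurable]: "gauss \<in> borel_measurable borel"
  by (rule borel_measurable_continuous_onI[OF continuous_on_gauss])

lemma
  fixes x :: "'a::euclidean_space"
  shows integrable_gauss_cos: "integrable lborel (\<lambda>\<omega>. gauss \<omega> * cos (x \<bullet> \<omega>))"
    and integral_gauss_cos: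
      "(LINT \<omega>|lborel. gauss \<omega> * cos (x \<bullet> \<omega>)) = sqrt (2 * pi) ^ DIM('a) * gauss x"
proof -
  let ?f = "\<lambda>b s. cis ((x \<bullet> b) * s) * exp (- s\<^sup>2 / 2)"
  have eq: "(\<Prod>b\<in>Basis. ?f b (\<omega> \<bullet> b)) = cis (x \<bullet> \<omega>) * gauss \<omega>" for \<omega> :: 'a
  proof -
    have factor: "cis u * exp v = exp (\<i> * of_real u + of_real v)" for u v :: real
      by (simp only: cis_conv_exp exp_add exp_of_real)
    have "(\<Prod>b\<in>Basis. ?f b (\<omega> \<bullet> b))
        = exp (\<Sum>b\<in>Basis. \<i> * of_real ((x \<bullet> b) * (\<omega> \<bullet> b)) + of_real (- (\<omega> \<bullet> b)\<^sup>2 / 2))"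
      unfolding factor by (rule exp_sum[symmetric]) simp
    also have "(\<Sum>b\<in>Basis. \<i> * of_real ((x \<bullet> b) * (\<omega> \<bullet> b)) + of_real (- (\<omega> \<bullet> b)\<^sup>2 / 2))
        = \<i> * of_real (x \<bullet> \<omega>) + of_real (- (norm \<omega>)\<^sup>2 / 2)"
      unfolding euclidean_inner[of x \<omega>] power2_norm_eq_inner euclidean_inner[of \<omega> \<omega>]
      by (simp add: sum.distrib sum_distrib_left sum_divide_distrib sum_negf sum_subtractf power2_eq_square)
    also have "exp \<dots> = cis (x \<bullet> \<omega>) * gauss \<omega>"
      unfolding gauss_def factor ..
    finally show ?thesis .
  qed
  have int: "integrable lborel (\<lambda>\<omega>::'a. cis (x \<bullet> \<omega>) * gauss \<omega>)"
    using integrable_lborel_prod_Basis[of ?f, OF integrable_gaussian_cis] unfolding eq .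
  have "(LINT \<omega>|lborel. cis (x \<bullet> \<omega>) * gauss \<omega>) = (\<Prod>b\<in>Basis. sqrt (2 * pi) * exp (- (x \<bullet> b)\<^sup>2 / 2))"
    using integral_lborel_prod_Basis[of ?f, OF integrable_gaussian_cis]
    unfolding eq integral_gaussian_cis by simp
  also have "\<dots> = of_real (sqrt (2 * pi) ^ DIM('a) * (\<Prod>b\<in>Basis. exp (- (x \<bullet> b)\<^sup>2 / 2)))"
    by (simp add: prod.distrib)
  also have "(\<Prod>b\<in>Basis. exp (- (x \<bullet> b)\<^sup>2 / 2)) = gauss x"
    unfolding gauss_def power2_norm_eq_inner euclidean_inner[of x x]
    by (simp add: exp_sum[symmetric] sum_negf sum_divide_distrib power2_eq_square)
  finally have *: "(LINT \<omega>|lborel. cis (x \<bullet> \<omega>) * gauss \<omega>) = of_real (sqrt (2 * pi) ^ DIM('a) * gauss x)" .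
  have re: "Re (cis (x \<bullet> \<omega>) * gauss \<omega>) = gauss \<omega> * cos (x \<bullet> \<omega>)" for \<omega>
    by simp
  show "integrable lborel (\<lambda>\<omega>. gauss \<omega> * cos (x \<bullet> \<omega>))"
    using integrable_Re[OF int] unfolding re .
  show "(LINT \<omega>|lborel. gauss \<omega> * cos (x \<bullet> \<omega>)) = sqrt (2 * pi) ^ DIM('a) * gauss x"
    using integral_Re[OF int] unfolding re * by simp
qed

lemma
  shows integrable_gauss: "integrable lborel (gauss :: 'a::euclidean_space \<Rightarrow> real)"
    and integral_gauss: "(LINT \<omega>|lborel. gauss (\<omega>::'a)) = sqrt (2 * pi) ^ DIM('a)"
  using integrable_gauss_cos[of "0::'a"] integral_gauss_cos[of "0::'a"] by (simp_all add: gauss_def[abs_def])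

lemma integrable_lborel_pair_mult:
  fixes f :: "'a::euclidean_space \<Rightarrow> real" and g :: "'b::euclidean_space \<Rightarrow> real"
  assumes f: "integrable lborel f" and g: "integrable lborel g"
  shows "integrable (lborel \<Otimes>\<^sub>M lborel) (\<lambda>(x, y). f x * g y)"
proof -
  have [measurable]: "f \<in> borel_measurable borel" "g \<in> borel_measurable borel"
    using f g by auto
  show ?thesis
  proof (rule lborel_pair.Fubini_integrable)
    show "integrable lborel (\<lambda>x. LINT y|lborel. norm ((\<lambda>(x, y). f x * g y) (x, y)))"
      using f by (simp add: abs_mult)
  qed (use g in auto)
qed

text \<open>The real form of \<open>\<Sum> a\<^sub>x a\<^sub>y cis (\<theta>\<^sub>x - \<theta>\<^sub>y) = |\<Sum> a\<^sub>x cis \<theta>\<^sub>x|\<^sup>2\<close>; the terms with \<open>sin v\<close> cancel by antisymmetry.\<close>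

lemma sum_cos_diff_eq:
  fixes a \<theta> :: "'i \<Rightarrow> real"
  shows "(\<Sum>x\<in>I. \<Sum>y\<in>I. a x * a y * cos (\<theta> x - \<theta> y - v))
    = cos v * ((\<Sum>x\<in>I. a x * cos (\<theta> x))\<^sup>2 + (\<Sum>x\<in>I. a x * sin (\<theta> x))\<^sup>2)"
proof -
  let ?c = "\<lambda>x. a x * cos (\<theta> x)" and ?s = "\<lambda>x. a x * sin (\<theta> x)"
  have "a x * a y * cos (\<theta> x - \<theta> y - v)
      = cos v * (?c x * ?c y) + cos v * (?s x * ?s y) + sin v * (?s x * ?c y) - sin v * (?c x * ?s y)"
    for x y unfolding cos_diff[of "\<theta> x - \<theta> y" v] by (simp add: cos_diff sin_diff algebra_simps)
  then have "(\<Sum>x\<in>I. \<Sum>y\<in>I. a x * a y * cos (\<theta> x - \<theta> y - v))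
      = cos v * (sum ?c I * sum ?c I) + cos v * (sum ?s I * sum ?s I)
        + sin v * (sum ?s I * sum ?c I) - sin v * (sum ?c I * sum ?s I)"
    by (simp add: sum.distrib sum_subtractf sum_distrib_left[symmetric] sum_product)
  then show ?thesis by (simp add: power2_eq_square algebra_simps)
qed

text \<open>Writing the Gaussian as the Fourier transform of a Gaussian and exchanging the integrals turns the
  quadratic form into the integral of the nonnegative Fourier transform of \<open>\<Phi>\<close> against
  \<open>|\<Sum> a\<^sub>x cis (p\<^sub>x \<bullet> \<omega> / t)|\<^sup>2\<close> and a positive weight.\<close>

lemma smoothed_kernel_psd:
  fixes \<Phi> :: "'a::euclidean_space \<Rightarrow> real" and p :: "'i \<Rightarrow> 'a"
  assumes int: "integrable lborel \<Phi>"
    and pos: "\<And>\<omega>. 0 \<le> (LINT u|lborel. \<Phi> u * cos (u \<bullet> \<omega>))"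
  shows "0 \<le> (\<Sum>x\<in>I. \<Sum>y\<in>I. a x * a y * (LINT u|lborel. \<Phi> u * gauss ((p x - p y - u) /\<^sub>R t)))"
proof -
  have [measurable]: "\<Phi> \<in> borel_measurable borel" using int by auto
  define S where "S = (\<lambda>\<omega> u. \<Sum>x\<in>I. \<Sum>y\<in>I. a x * a y * cos (((p x - p y - u) /\<^sub>R t) \<bullet> \<omega>))"
  define C where "C = sqrt (2 * pi) ^ DIM('a)"
  have C: "C > 0" by (simp add: C_def)
  have S_bound: "\<bar>S \<omega> u\<bar> \<le> (\<Sum>x\<in>I. \<Sum>y\<in>I. \<bar>a x * a y\<bar>)" for \<omega> u
    unfolding S_def
    by (intro order.trans[OF sum_abs] sum_mono) (auto simp: abs_mult mult_left_le)
  have "S \<omega> u = cos ((u /\<^sub>R t) \<bullet> \<omega>) * ((\<Sum>x\<in>I. a x * cos ((p x /\<^sub>R t) \<bullet> \<omega>))\<^sup>2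
      + (\<Sum>x\<in>I. a x * sin ((p x /\<^sub>R t) \<bullet> \<omega>))\<^sup>2)" (is "_ = _ * ?Q \<omega>") for \<omega> u
    unfolding S_def sum_cos_diff_eq[symmetric] by (simp add: inner_diff_left right_diff_distrib)
  then have S_eq: "gauss \<omega> * \<Phi> u * S \<omega> u = gauss \<omega> * ?Q \<omega> * (\<Phi> u * cos (u \<bullet> (\<omega> /\<^sub>R t)))" for \<omega> u
    by (simp add: mult_ac)
  have inner: "(LINT u|lborel. gauss \<omega> * \<Phi> u * S \<omega> u)
      = gauss \<omega> * ?Q \<omega> * (LINT u|lborel. \<Phi> u * cos (u \<bullet> (\<omega> /\<^sub>R t)))" for \<omega>
    unfolding S_eq by (rule integral_mult_right_zero)
  have Sm[measurable]: "(\<lambda>(\<omega>, u). S \<omega> u) \<in> borel_measurable (lborel \<Otimes>\<^sub>M lborel)"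
    unfolding S_def by measurable
  have "integrable (lborel \<Otimes>\<^sub>M lborel) (\<lambda>z. (case z of (\<omega>, u) \<Rightarrow> gauss \<omega> * \<Phi> u) * (\<Sum>x\<in>I. \<Sum>y\<in>I. \<bar>a x * a y\<bar>))"
    by (intro integrable_mult_left integrable_lborel_pair_mult integrable_gauss int)
  then have joint: "integrable (lborel \<Otimes>\<^sub>M lborel) (\<lambda>(\<omega>, u). gauss \<omega> * \<Phi> u * S \<omega> u)"
  proof (rule Bochner_Integration.integrable_bound)
    show "(\<lambda>(\<omega>, u). gauss \<omega> * \<Phi> u * S \<omega> u) \<in> borel_measurable (lborel \<Otimes>\<^sub>M lborel)"
      by measurable
    show "AE z in lborel \<Otimes>\<^sub>M lborel. norm (case z of (\<omega>, u) \<Rightarrow> gauss \<omega> * \<Phi> u * S \<omega> u)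
      \<le> norm ((case z of (\<omega>, u) \<Rightarrow> gauss \<omega> * \<Phi> u) * (\<Sum>x\<in>I. \<Sum>y\<in>I. \<bar>a x * a y\<bar>))"
    proof (rule AE_I2, clarsimp simp only: prod.case)
      fix \<omega> u
      show "norm (gauss \<omega> * \<Phi> u * S \<omega> u) \<le> norm (gauss \<omega> * \<Phi> u * (\<Sum>x\<in>I. \<Sum>y\<in>I. \<bar>a x * a y\<bar>))"
        unfolding norm_mult
        by (intro mult_left_mono) (auto intro!: order.trans[OF S_bound] mult_nonneg_nonneg)
    qed
  qed
  have "0 \<le> (LINT \<omega>|lborel. (LINT u|lborel. gauss \<omega> * \<Phi> u * S \<omega> u))"
    unfolding inner
    by (intro integral_nonneg_AE AE_I2 mult_nonneg_nonneg pos) (auto intro: less_imp_le gauss_pos)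
  also have "\<dots> = (LINT u|lborel. (LINT \<omega>|lborel. gauss \<omega> * \<Phi> u * S \<omega> u))"
    using lborel_pair.Fubini_integral[OF joint] by simp
  also have "\<dots> = (LINT u|lborel. C * (\<Sum>x\<in>I. \<Sum>y\<in>I. a x * a y * (\<Phi> u * gauss ((p x - p y - u) /\<^sub>R t))))"
  proof (rule Bochner_Integration.integral_cong[OF refl])
    fix u
    have "(LINT \<omega>|lborel. gauss \<omega> * \<Phi> u * S \<omega> u)
       = (LINT \<omega>|lborel. (\<Sum>x\<in>I. \<Sum>y\<in>I. (a x * a y * \<Phi> u)
            * (gauss \<omega> * cos (((p x - p y - u) /\<^sub>R t) \<bullet> \<omega>))))"
      by (simp add: S_def sum_distrib_left mult_ac)
    also have "\<dots> = (\<Sum>x\<in>I. \<Sum>y\<in>I. (a x * a y * \<Phi> u) * (C * gauss ((p x - p y - u) /\<^sub>R t)))"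
      by (simp add: Bochner_Integration.integral_sum integrable_gauss_cos integral_gauss_cos C_def
          del: inner_scaleR_left)
    also have "\<dots> = C * (\<Sum>x\<in>I. \<Sum>y\<in>I. a x * a y * (\<Phi> u * gauss ((p x - p y - u) /\<^sub>R t)))"
      by (simp add: sum_distrib_left mult_ac)
    finally show "(LINT \<omega>|lborel. gauss \<omega> * \<Phi> u * S \<omega> u)
      = C * (\<Sum>x\<in>I. \<Sum>y\<in>I. a x * a y * (\<Phi> u * gauss ((p x - p y - u) /\<^sub>R t)))" .
  qed
  also have "\<dots> = C * (\<Sum>x\<in>I. \<Sum>y\<in>I. a x * a y * (LINT u|lborel. \<Phi> u * gauss ((p x - p y - u) /\<^sub>R t)))"
  proof -
    have "integrable lborel (\<lambda>u. \<Phi> u * gauss ((z - u) /\<^sub>R t))" for z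
    proof (rule Bochner_Integration.integrable_bound[OF int])
      show "AE u in lborel. norm (\<Phi> u * gauss ((z - u) /\<^sub>R t)) \<le> norm (\<Phi> u)"
        by (rule AE_I2) (auto simp: abs_mult gauss_def intro!: mult_left_le)
    qed measurable
    then show ?thesis by (simp add: Bochner_Integration.integral_sum)
  qed
  finally show ?thesis using C by (simp add: zero_le_mult_iff)
qed

lemma integral_gauss_convolution:
  fixes \<Phi> :: "'a::euclidean_space \<Rightarrow> real"
  assumes [measurable]: "\<Phi> \<in> borel_measurable borel" and t: "t > 0"
  shows "(LINT u|lborel. \<Phi> u * gauss ((z - u) /\<^sub>R t))
    = t ^ DIM('a) * (LINT w|lborel. \<Phi> (z - t *\<^sub>R w) * gauss w)"
proof -
  have "(LINT u|lborel. \<Phi> u * gauss ((z - u) /\<^sub>R t))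
     = (LINT u|density (distr lborel borel (\<lambda>x. z + (- t) *\<^sub>R x)) (\<lambda>_. ennreal (\<bar>- t\<bar> ^ DIM('a))). \<Phi> u * gauss ((z - u) /\<^sub>R t))"
    using lborel_affine[of "- t" z] t by simp
  also have "\<dots> = (LINT w|lborel. t ^ DIM('a) * (\<Phi> (z - t *\<^sub>R w) * gauss w))"
    using t by (simp add: integral_density integral_distr)
  finally show ?thesis by simp
qed

text \<open>The easy half of Bochner's theorem. Fourier inversion is avoided: the smoothed kernels of the
  preceding lemma, divided by the mass of the scaled Gaussian, tend to \<open>\<Phi>\<close> pointwise as \<open>t\<close> tends to 0.\<close>

theorem continuous_psd_of_nonneg_fourier:
  fixes \<Phi> :: "'a::euclidean_space \<Rightarrow> real" and p :: "'i \<Rightarrow> 'a"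
  assumes cont: "continuous_on UNIV \<Phi>" and int: "integrable lborel \<Phi>"
    and bound: "\<And>x. \<bar>\<Phi> x\<bar> \<le> K"
    and pos: "\<And>\<omega>. 0 \<le> (LINT u|lborel. \<Phi> u * cos (u \<bullet> \<omega>))"
  shows "0 \<le> (\<Sum>x\<in>I. \<Sum>y\<in>I. a x * a y * \<Phi> (p x - p y))"
proof -
  have [measurable]: "\<Phi> \<in> borel_measurable borel" using int by auto
  define t :: "nat \<Rightarrow> real" where "t = (\<lambda>m. 1 / real (Suc m))"
  have t: "t m > 0" for m by (simp add: t_def)
  have t0: "t \<longlonglongrightarrow> 0" unfolding t_def using LIMSEQ_inverse_real_of_nat by (simp add: inverse_eq_divide)
  define A where "A = (\<lambda>z m. LINT w|lborel. \<Phi> (z - t m *\<^sub>R w) * gauss w)"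
  let ?C = "sqrt (2 * pi) ^ DIM('a)"
  have lim: "A z \<longlonglongrightarrow> \<Phi> z * ?C" for z
  proof -
    have "A z \<longlonglongrightarrow> (LINT w|lborel. \<Phi> z * gauss (w::'a))"
      unfolding A_def
    proof (rule integral_dominated_convergence[where w = "\<lambda>w::'a. K * gauss w"])
      show "AE w in lborel. (\<lambda>m. \<Phi> (z - t m *\<^sub>R w) * gauss w) \<longlonglongrightarrow> \<Phi> z * gauss w"
      proof (rule AE_I2)
        fix w
        have "(\<lambda>m. z - t m *\<^sub>R w) \<longlonglongrightarrow> z - 0 *\<^sub>R w"
          by (intro tendsto_intros t0)
        then have "(\<lambda>m. \<Phi> (z - t m *\<^sub>R w)) \<longlonglongrightarrow> \<Phi> (z - 0 *\<^sub>R w)"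
          by (rule continuous_on_tendsto_compose[OF cont]) auto
        then show "(\<lambda>m. \<Phi> (z - t m *\<^sub>R w) * gauss w) \<longlonglongrightarrow> \<Phi> z * gauss w"
          by (intro tendsto_mult tendsto_const) simp
      qed
      show "AE w in lborel. norm (\<Phi> (z - t m *\<^sub>R w) * gauss w) \<le> K * gauss w" for m
        by (rule AE_I2) (auto simp: abs_mult gauss_pos less_imp_le intro!: mult_right_mono bound)
    qed (auto intro: integrable_gauss)
    then show ?thesis by (simp add: integral_gauss)
  qed
  have nonneg: "0 \<le> (\<Sum>x\<in>I. \<Sum>y\<in>I. a x * a y * A (p x - p y) m)" for m
  proof -
    have "0 \<le> t m ^ DIM('a) * (\<Sum>x\<in>I. \<Sum>y\<in>I. a x * a y * A (p x - p y) m)"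
      using smoothed_kernel_psd[where I = I and a = a and p = p and t = "t m", OF int pos]
      unfolding integral_gauss_convolution[OF \<open>\<Phi> \<in> borel_measurable borel\<close> t] A_def
      by (simp add: sum_distrib_left mult_ac)
    then show ?thesis using zero_less_power[OF t[of m], of "DIM('a)"] by (auto simp: zero_le_mult_iff)
  qed
  have "(\<lambda>m. \<Sum>x\<in>I. \<Sum>y\<in>I. a x * a y * A (p x - p y) m)
      \<longlonglongrightarrow> (\<Sum>x\<in>I. \<Sum>y\<in>I. a x * a y * (\<Phi> (p x - p y) * ?C))"
    by (intro tendsto_sum tendsto_mult tendsto_const lim)
  then have "0 \<le> (\<Sum>x\<in>I. \<Sum>y\<in>I. a x * a y * (\<Phi> (p x - p y) * ?C))"
    by (rule LIMSEQ_le_const) (use nonneg in auto)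
  also have "\<dots> = ?C * (\<Sum>x\<in>I. \<Sum>y\<in>I. a x * a y * \<Phi> (p x - p y))"
    by (simp add: sum_distrib_left mult_ac)
  finally show ?thesis
    by (rule mult_left_le_imp_le[of ?C 0, simplified mult_zero_right]) simp
qed


section \<open>Separated point sets\<close>

text \<open>The open balls of radius \<open>q\<close> around the points are disjoint and lie in a ball of radius \<open>r + q\<close>;
  compare volumes.\<close>

lemma card_inter_cball_le:
  fixes Y :: "(real^'d) set"
  assumes fin: "finite Y" and q: "q > 0" and r: "r \<ge> 0"
    and sep: "\<And>x y. x \<in> Y \<Longrightarrow> y \<in> Y \<Longrightarrow> x \<noteq> y \<Longrightarrow> 2 * q \<le> norm (x - y)"
  shows "real (card (Y \<inter> cball z r)) \<le> (1 + r / q) ^ CARD('d)"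
proof -
  let ?Z = "Y \<inter> cball z r"
  let ?c = "measure lborel (ball (0::real^'d) 1)"
  have c: "?c > 0" by (rule content_ball_pos) simp
  have "real (card ?Z) * (q ^ CARD('d) * ?c) = (\<Sum>x\<in>?Z. measure lborel (ball x q))"
    using content_ball_conv_unit_ball[of q "_ :: real^'d"] q by simp
  also have "\<dots> = measure lborel (\<Union>x\<in>?Z. ball x q)"
  proof (rule measure_finite_Union[symmetric])
    show "disjoint_family_on (\<lambda>x. ball x q) ?Z"
      unfolding disjoint_family_on_def
    proof (intro ballI impI)
      fix x y assume "x \<in> ?Z" "y \<in> ?Z" "x \<noteq> y"
      then have "2 * q \<le> dist x y" using sep[of x y] by (simp add: dist_norm)
      then show "ball x q \<inter> ball y q = {}" by (intro disjoint_ballI) simp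
    qed
  qed (use fin emeasure_lborel_ball_finite in \<open>auto simp: less_top[symmetric]\<close>)
  also have "\<dots> \<le> measure lborel (ball z (r + q))"
  proof (rule measure_mono_fmeasurable)
    show "(\<Union>x\<in>?Z. ball x q) \<subseteq> ball z (r + q)"
    proof clarsimp
      fix x y assume "dist z x \<le> r" "dist x y < q"
      then show "dist z y < r + q" using dist_triangle[of z y x] by linarith
    qed
    show "(\<Union>x\<in>?Z. ball x q) \<in> sets lborel"
      using fin by (intro sets.finite_UN) auto
    show "ball z (r + q) \<in> fmeasurable lborel"
      using emeasure_lborel_ball_finite[of z "r + q"] by (intro fmeasurableI) auto
  qed
  also have "\<dots> = (r + q) ^ CARD('d) * ?c"
    using content_ball_conv_unit_ball[of "r + q" z] q r by simp
  finally have "real (card ?Z) * q ^ CARD('d) \<le> (r + q) ^ CARD('d)"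
    unfolding mult.assoc[symmetric] using c by (rule mult_right_le_imp_le)
  then have "real (card ?Z) \<le> (r + q) ^ CARD('d) / q ^ CARD('d)"
    using q by (subst pos_le_divide_eq) auto
  also have "\<dots> = (1 + r / q) ^ CARD('d)"
    using q by (simp add: power_divide[symmetric] add_divide_distrib add.commute)
  finally show ?thesis .
qed

text \<open>Bounds every sum of \<open>exp (- \<alpha> * |x - z| / q)\<close> over a set of separation distance \<open>q\<close>: the shell
  \<open>n \<le> |x - z| / q < n + 1\<close> contains at most \<open>(n + 2) ^ d\<close> points.\<close>

definition decay_sum :: "nat \<Rightarrow> real \<Rightarrow> real" where
  "decay_sum d \<alpha> = (\<Sum>n. (real n + 2) ^ d * exp (- \<alpha> * real n))"

lemma power_le_fact_mult_exp:
  fixes t :: real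
  assumes "t \<ge> 0"
  shows "t ^ d \<le> fact d * exp t"
proof -
  have "t ^ d /\<^sub>R fact d \<le> (\<Sum>n\<in>{d}. t ^ n /\<^sub>R fact n)" by simp
  also have "\<dots> \<le> exp t"
    unfolding exp_def by (rule sum_le_suminf[OF summable_exp_generic]) (use assms in auto)
  finally show ?thesis by (simp add: field_simps)
qed

lemma summable_decay_sum:
  assumes "\<alpha> > 0"
  shows "summable (\<lambda>n. (real n + 2) ^ d * exp (- \<alpha> * real n))"
proof (rule summable_comparison_test')
  let ?C = "fact d * (2 / \<alpha>) ^ d * exp \<alpha>"
  have "summable (\<lambda>n. exp (- (\<alpha> / 2)) ^ n)"
    using assms by (intro summable_geometric) simp
  then show "summable (\<lambda>n. ?C * exp (- (\<alpha> / 2)) ^ n)"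
    by (rule summable_mult)
  fix n :: nat assume "n \<ge> 0"
  have "(\<alpha> / 2 * (real n + 2)) ^ d \<le> fact d * exp (\<alpha> / 2 * (real n + 2))"
    by (rule power_le_fact_mult_exp) (use assms in simp)
  then have "(2 / \<alpha>) ^ d * (\<alpha> / 2 * (real n + 2)) ^ d
      \<le> (2 / \<alpha>) ^ d * (fact d * exp (\<alpha> / 2 * (real n + 2)))"
    using assms by (intro mult_left_mono) auto
  then have "(real n + 2) ^ d \<le> (2 / \<alpha>) ^ d * (fact d * exp (\<alpha> / 2 * (real n + 2)))"
    using assms by (simp add: power_mult_distrib power_divide)
  then have "(real n + 2) ^ d * exp (- \<alpha> * real n)
      \<le> (2 / \<alpha>) ^ d * (fact d * exp (\<alpha> / 2 * (real n + 2))) * exp (- \<alpha> * real n)"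
    by (intro mult_right_mono) auto
  also have "\<dots> = ?C * exp (- (\<alpha> / 2)) ^ n"
    by (simp add: exp_of_nat_mult[symmetric] exp_add[symmetric] mult.assoc)
      (simp add: field_simps)
  finally show "norm ((real n + 2) ^ d * exp (- \<alpha> * real n)) \<le> ?C * exp (- (\<alpha> / 2)) ^ n"
    by simp
qed

lemma decay_sum_pos:
  assumes "\<alpha> > 0" shows "decay_sum d \<alpha> > 0"
  unfolding decay_sum_def by (rule suminf_pos[OF summable_decay_sum[OF assms]]) simp

lemma sum_exp_dist_le_decay_sum:
  fixes Y :: "(real^'d) set"
  assumes fin: "finite Y" and q: "q > 0" and \<alpha>: "\<alpha> > 0"
    and sep: "\<And>x y. x \<in> Y \<Longrightarrow> y \<in> Y \<Longrightarrow> x \<noteq> y \<Longrightarrow> 2 * q \<le> norm (x - y)"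
  shows "(\<Sum>x\<in>Y. exp (- \<alpha> * norm (x - z) / q)) \<le> decay_sum CARD('d) \<alpha>"
proof -
  define n where "n = (\<lambda>x. nat \<lfloor>norm (x - z) / q\<rfloor>)"
  have n: "real (n x) \<le> norm (x - z) / q" "norm (x - z) / q \<le> real (n x) + 1" for x
    using q unfolding n_def by (simp_all add: of_nat_nat)
  have "(\<Sum>x\<in>Y. exp (- \<alpha> * norm (x - z) / q)) \<le> (\<Sum>x\<in>Y. exp (- \<alpha> * real (n x)))"
  proof (intro sum_mono)
    fix x
    have "\<alpha> * real (n x) \<le> \<alpha> * (norm (x - z) / q)"
      using n(1)[of x] \<alpha> by (intro mult_left_mono) auto
    then show "exp (- \<alpha> * norm (x - z) / q) \<le> exp (- \<alpha> * real (n x))" by simp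
  qed
  also have "\<dots> = (\<Sum>m\<in>n ` Y. \<Sum>x\<in>{x \<in> Y. n x = m}. exp (- \<alpha> * real (n x)))"
    using fin by (rule sum.image_gen)
  also have "\<dots> \<le> (\<Sum>m\<in>n ` Y. (real m + 2) ^ CARD('d) * exp (- \<alpha> * real m))"
  proof (intro sum_mono)
    fix m
    have sub: "{x \<in> Y. n x = m} \<subseteq> Y \<inter> cball z ((real m + 1) * q)"
    proof
      fix x assume "x \<in> {x \<in> Y. n x = m}"
      then show "x \<in> Y \<inter> cball z ((real m + 1) * q)"
        using n(2)[of x] q by (auto simp: dist_norm norm_minus_commute field_simps)
    qed
    have "real (card {x \<in> Y. n x = m}) \<le> real (card (Y \<inter> cball z ((real m + 1) * q)))"
      using fin by (intro of_nat_mono card_mono sub) auto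
    also have "\<dots> \<le> (1 + (real m + 1) * q / q) ^ CARD('d)"
      using q by (intro card_inter_cball_le fin sep) auto
    also have "\<dots> = (real m + 2) ^ CARD('d)"
      using q by (simp add: add.commute)
    finally show "(\<Sum>x\<in>{x \<in> Y. n x = m}. exp (- \<alpha> * real (n x)))
        \<le> (real m + 2) ^ CARD('d) * exp (- \<alpha> * real m)"
      by (simp add: mult_right_mono)
  qed
  also have "\<dots> \<le> decay_sum CARD('d) \<alpha>"
    unfolding decay_sum_def
    by (rule sum_le_suminf[OF summable_decay_sum[OF \<alpha>]]) (use fin in auto)
  finally show ?thesis .
qed

lemma sep_dist_pos:
  fixes Y :: "(real^'d) set"
  assumes "finite Y" "2 \<le> card Y"
  shows "sep_dist Y > 0" and "\<And>x y. x \<in> Y \<Longrightarrow> y \<in> Y \<Longrightarrow> x \<noteq> y \<Longrightarrow> 2 * sep_dist Y \<le> norm (x - y)"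
proof -
  let ?D = "{norm (x - y) |x y. x \<in> Y \<and> y \<in> Y \<and> x \<noteq> y}"
  have fin: "finite ?D"
    by (rule finite_subset[of _ "(\<lambda>(x, y). norm (x - y)) ` (Y \<times> Y)"]) (use assms(1) in auto)
  obtain x y where "x \<in> Y" "y \<in> Y" "x \<noteq> y"
    using assms by (metis card_le_Suc0_iff_eq not_less_eq_eq numeral_2_eq_2)
  then have ne: "?D \<noteq> {}" by auto
  show "sep_dist Y > 0"
    unfolding sep_dist_def using fin ne by auto
  show "2 * sep_dist Y \<le> norm (x - y)" if "x \<in> Y" "y \<in> Y" "x \<noteq> y" for x y
    unfolding sep_dist_def using fin that by (auto intro!: Min_le)
qed

section \<open>Maximum norms\<close>

lemma Linf_norm_le:
  fixes g :: "real^'d \<Rightarrow> real"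
  assumes g: "continuous_on UNIV g" and \<Omega>: "open \<Omega>" and le: "\<And>x. x \<in> \<Omega> \<Longrightarrow> ereal \<bar>g x\<bar> \<le> C"
  shows "Linf_norm \<Omega> g \<le> C"
  unfolding Linf_norm_def
proof (rule esssup_I)
  have [measurable]: "g \<in> borel_measurable borel"
    using g by (rule borel_measurable_continuous_onI)
  have "(\<lambda>x. ereal \<bar>g x\<bar>) \<in> borel_measurable lborel" by measurable
  then show "(\<lambda>x. ereal \<bar>g x\<bar>) \<in> borel_measurable (restrict_space lborel \<Omega>)"
    by (rule measurable_restrict_space1)
  show "AE x in restrict_space lborel \<Omega>. ereal \<bar>g x\<bar> \<le> C"
    by (rule AE_I2) (auto simp: space_restrict_space intro: le)
qed

text \<open>A continuous function cannot exceed its essential supremum on an open set, since it would do so on a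
  nonempty open set, which has positive measure.\<close>

lemma abs_le_Linf_norm:
  fixes g :: "real^'d \<Rightarrow> real"
  assumes g: "continuous_on UNIV g" and \<Omega>: "open \<Omega>" and x: "x \<in> \<Omega>"
  shows "ereal \<bar>g x\<bar> \<le> Linf_norm \<Omega> g"
proof (rule ccontr)
  assume "\<not> ereal \<bar>g x\<bar> \<le> Linf_norm \<Omega> g"
  then obtain c where c: "Linf_norm \<Omega> g < ereal c" "ereal c < ereal \<bar>g x\<bar>"
    using ereal_dense2 by (metis not_less)
  have "AE y in restrict_space lborel \<Omega>. ereal \<bar>g y\<bar> \<le> Linf_norm \<Omega> g"
    unfolding Linf_norm_def by (rule esssup_AE)
  then have "AE y in lborel. y \<in> \<Omega> \<longrightarrow> ereal \<bar>g y\<bar> \<le> Linf_norm \<Omega> g"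
    using \<Omega> by (subst (asm) AE_restrict_space_iff) auto
  then have ae: "AE y in lborel. y \<notin> {y \<in> \<Omega>. c < \<bar>g y\<bar>}"
  proof eventually_elim
    case (elim y)
    then show ?case using c(1) by (auto dest: order.strict_trans1)
  qed
  have "open (\<Omega> \<inter> (\<lambda>y. \<bar>g y\<bar>) -` {c<..})"
    using g \<Omega> by (intro open_Int open_vimage continuous_intros) auto
  then have op: "open {y \<in> \<Omega>. c < \<bar>g y\<bar>}"
    by (simp add: vimage_def Int_def)
  then have "{y \<in> \<Omega>. c < \<bar>g y\<bar>} \<in> null_sets lborel"
    using ae by (subst AE_iff_null_sets) auto
  then have "negligible {y \<in> \<Omega>. c < \<bar>g y\<bar>}"
    by (simp add: negligible_iff_null_sets null_sets_completionI)
  moreover have "x \<in> {y \<in> \<Omega>. c < \<bar>g y\<bar>}"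
    using x c(2) by simp
  ultimately show False
    using op open_not_negligible by blast
qed

lemma abs_le_linf_norm: "finite Y \<Longrightarrow> x \<in> Y \<Longrightarrow> \<bar>g x\<bar> \<le> linf_norm Y g"
  by (auto simp: linf_norm_def)

lemma linf_norm_nonneg: "finite Y \<Longrightarrow> 0 \<le> linf_norm Y g"
  by (cases "Y = {}") (auto simp: linf_norm_def Max_ge_iff)

lemma linf_norm_mono: "finite Z \<Longrightarrow> Y \<subseteq> Z \<Longrightarrow> linf_norm Y g \<le> linf_norm Z g"
proof (cases "Y = {}")
  case True
  then show "finite Z \<Longrightarrow> linf_norm Y g \<le> linf_norm Z g"
    using linf_norm_nonneg[of Z g] by (simp add: linf_norm_def)
qed (auto simp: linf_norm_def intro!: Max_mono)


section \<open>Cardinal functions on one level\<close>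

text \<open>The row sums of the Gram matrix scale like \<open>q ^ (- d)\<close> and those of its inverse like \<open>q ^ d\<close>. The next
  two constants bound the scaled row sums of the former and the product of the two, uniformly in the
  level.\<close>

definition interaction_bound :: "nat \<Rightarrow> real \<Rightarrow> real \<Rightarrow> real \<Rightarrow> real" where
  "interaction_bound d K0 \<nu> cq = K0 / \<nu> ^ d * (1 + \<nu> * cq) ^ d"

definition condition_bound :: "nat \<Rightarrow> real \<Rightarrow> real \<Rightarrow> real \<Rightarrow> real \<Rightarrow> real \<Rightarrow> real" where
  "condition_bound d K0 \<nu> cq cA \<theta> = cA * decay_sum d \<theta> * interaction_bound d K0 \<nu> cq"

text \<open>The rate of the weight in the Combes-Thomas argument. It is chosen such that over the range of the
  kernel, at most \<open>\<nu> * cq\<close> separation distances, the weight grows by the factor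
  \<open>1 + 1 / (2 * \<kappa>0\<^sup>2)\<close> at most; the perturbation is then at most half of the coercivity constant.\<close>

definition local_rate :: "real \<Rightarrow> real \<Rightarrow> real \<Rightarrow> real" where
  "local_rate \<kappa>0 \<nu> cq = ln (1 + 1 / (2 * \<kappa>0\<^sup>2)) / (\<nu> * cq)"

definition local_lebesgue :: "nat \<Rightarrow> real \<Rightarrow> real \<Rightarrow> real \<Rightarrow> real" where
  "local_lebesgue d \<kappa>0 \<nu> cq = (2 * \<kappa>0\<^sup>2 + 1) * decay_sum d (local_rate \<kappa>0 \<nu> cq)"

definition localization_const ::
  "nat \<Rightarrow> real \<Rightarrow> real \<Rightarrow> real \<Rightarrow> real \<Rightarrow> real \<Rightarrow> real \<Rightarrow> real \<Rightarrow> real" where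
  "localization_const d K0 R \<nu> cq cA c\<chi> \<theta> =
     c\<chi> * decay_sum d \<theta> * interaction_bound d K0 \<nu> cq * cA * (2 * R * cq) ^ d"

lemma abs_exp_minus_1_le:
  fixes t :: real
  assumes "\<bar>t\<bar> \<le> s"
  shows "\<bar>exp t - 1\<bar> \<le> exp s - 1"
proof (cases "t \<ge> 0")
  case True
  then show ?thesis using assms by simp
next
  case False
  have "1 - exp t \<le> - t" using exp_ge_add_one_self[of t] by linarith
  also have "\<dots> \<le> exp s - 1" using exp_ge_add_one_self[of s] assms by linarith
  finally show ?thesis using False by simp
qed

text \<open>What is used about a single level. The defined parameters \<open>M\<close> and \<open>\<beta>\<close> bound the row sums of the
  Gram matrix and of its inverse \<open>B\<close>;
  \<open>\<kappa>0\<close> bounds \<open>\<beta> * M\<close> and thereby the condition number, without reference to the level.\<close>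

locale cardinal_level =
  fixes \<Phi> :: "real^'d \<Rightarrow> real" and \<Omega> Y :: "(real^'d) set" and K0 R \<nu> cq cA c\<chi> \<theta> :: real
    and B :: "real^'d \<Rightarrow> real^'d \<Rightarrow> real"
  fixes h q K M \<beta> \<kappa>0 \<sigma>
  defines "h \<equiv> fill_dist \<Omega> Y" and "q \<equiv> sep_dist Y"
    and "K \<equiv> level_kernel \<Phi> \<nu> \<Omega> Y"
    and "M \<equiv> K0 / (\<nu> * h) ^ CARD('d) * (1 + \<nu> * cq) ^ CARD('d)"
    and "\<beta> \<equiv> cA * q ^ CARD('d) * decay_sum CARD('d) \<theta>"
    and "\<kappa>0 \<equiv> condition_bound CARD('d) K0 \<nu> cq cA \<theta>"
    and "\<sigma> \<equiv> local_rate \<kappa>0 \<nu> cq"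
  assumes \<Phi>_cont: "continuous_on UNIV \<Phi>"
    and \<Phi>_even: "\<And>x. \<Phi> (- x) = \<Phi> x"
    and \<Phi>_bound: "\<And>x. \<bar>\<Phi> x\<bar> \<le> K0" and K0: "K0 > 0"
    and \<Phi>_supp: "\<And>x. norm x > 1 \<Longrightarrow> \<Phi> x = 0"
    and \<Phi>_psd: "\<And>(I :: (real^'d) set) a p. 0 \<le> (\<Sum>x\<in>I. \<Sum>y\<in>I. a x * a y * \<Phi> (p x - p y))"
    and pos: "\<nu> > 0" "cq > 0" "cA > 0" "c\<chi> > 0" "\<theta> > 0" "R > 0"
    and fin: "finite Y" and two: "2 \<le> card Y" and YR: "Y \<subseteq> cball 0 R"
    and qh: "q \<le> h" and hq: "h \<le> cq * q"
    and inv: "is_gram_inverse K Y B"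
    and B_decay: "\<And>x y. x \<in> Y \<Longrightarrow> y \<in> Y \<Longrightarrow> \<bar>B x y\<bar> \<le> cA * q ^ CARD('d) * exp (- \<theta> * norm (x - y) / q)"
    and chi_decay: "\<And>x y. x \<in> Y \<Longrightarrow> \<bar>chi \<Phi> \<nu> \<Omega> Y x y\<bar> \<le> c\<chi> * exp (- \<theta> * norm (x - y) / q)"
begin

lemma q_pos: "q > 0" and sep: "\<And>x y. x \<in> Y \<Longrightarrow> y \<in> Y \<Longrightarrow> x \<noteq> y \<Longrightarrow> 2 * q \<le> norm (x - y)"
  using sep_dist_pos[OF fin two] unfolding q_def by auto

lemma h_pos: "h > 0" using q_pos qh by simp

lemma K_eq: "K x y = \<Phi> ((x - y) /\<^sub>R (\<nu> * h)) / (\<nu> * h) ^ CARD('d)"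
  by (simp add: K_def level_kernel_def scaled_def h_def)

lemma K_sym: "K x y = K y x"
  using \<Phi>_even[of "(x - y) /\<^sub>R (\<nu> * h)"] unfolding K_eq by (simp flip: scaleR_minus_right)

lemma K_psd: "0 \<le> bilin K P w w"
proof -
  have "bilin K P w w = (\<Sum>x\<in>P. \<Sum>y\<in>P. w x * w y * \<Phi> (x /\<^sub>R (\<nu> * h) - y /\<^sub>R (\<nu> * h))) / (\<nu> * h) ^ CARD('d)"
    by (simp add: bilin_def K_eq sum_divide_distrib scaleR_diff_right mult_ac)
  then show ?thesis using \<Phi>_psd[where p = "\<lambda>x. x /\<^sub>R (\<nu> * h)"] pos h_pos by simp
qed

lemma K_bound: "\<bar>K x y\<bar> \<le> K0 / (\<nu> * h) ^ CARD('d)"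
  using \<Phi>_bound pos h_pos unfolding K_eq by (simp add: divide_right_mono abs_mult power_abs)

lemma K_local: "\<nu> * h < norm (x - y) \<Longrightarrow> K x y = 0"
proof -
  assume "\<nu> * h < norm (x - y)"
  then have "1 < norm (x - y) / (\<nu> * h)"
    using pos h_pos by (subst pos_less_divide_eq) auto
  then have "1 < norm ((x - y) /\<^sub>R (\<nu> * h))"
    using pos h_pos by (simp add: divide_inverse abs_mult mult_ac)
  then show "K x y = 0" unfolding K_eq by (simp only: \<Phi>_supp div_0)
qed

lemma K_cont: "continuous_on UNIV (\<lambda>z. K z y)"
  unfolding K_eq using pos h_pos
  by (intro continuous_intros continuous_on_compose2[OF \<Phi>_cont]) auto

lemma K_comb_cont: "continuous_on UNIV (kernel_comb K P b)"
  unfolding kernel_comb_def by (intro continuous_intros K_cont)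

lemma overlap_pos: "1 + \<nu> * cq > 0"
  using pos by (simp add: add_pos_pos)

lemma M_pos: "M > 0"
  unfolding M_def using K0 pos h_pos overlap_pos by simp

lemma \<beta>_pos: "\<beta> > 0"
  unfolding \<beta>_def using pos q_pos decay_sum_pos by simp

lemma interaction_pos: "interaction_bound CARD('d) K0 \<nu> cq > 0"
  unfolding interaction_bound_def using K0 pos overlap_pos by simp

lemma \<kappa>0_pos: "\<kappa>0 > 0"
  unfolding \<kappa>0_def condition_bound_def using interaction_pos pos decay_sum_pos by simp

lemma \<sigma>_pos: "\<sigma> > 0"
  unfolding \<sigma>_def local_rate_def using \<kappa>0_pos pos by (intro divide_pos_pos ln_gt_zero) auto

lemma exp_\<sigma>: "exp (\<sigma> * (\<nu> * cq)) = 1 + 1 / (2 * \<kappa>0\<^sup>2)"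
  unfolding \<sigma>_def local_rate_def using \<kappa>0_pos pos by (simp add: add_pos_nonneg)

lemma M_q_le: "M * q ^ CARD('d) \<le> interaction_bound CARD('d) K0 \<nu> cq"
proof -
  have "M * q ^ CARD('d) = interaction_bound CARD('d) K0 \<nu> cq * (q / h) ^ CARD('d)"
    unfolding M_def interaction_bound_def by (simp add: power_mult_distrib power_divide)
  also have "\<dots> \<le> interaction_bound CARD('d) K0 \<nu> cq * 1"
    using interaction_pos q_pos h_pos qh by (intro mult_left_mono power_le_one) auto
  finally show ?thesis by simp
qed

lemma \<beta>_M_le: "\<beta> * M \<le> \<kappa>0"
proof -
  have "\<beta> * M = cA * decay_sum CARD('d) \<theta> * (M * q ^ CARD('d))"
    by (simp add: \<beta>_def)
  also have "\<dots> \<le> \<kappa>0"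
    unfolding \<kappa>0_def condition_bound_def using M_q_le pos decay_sum_pos[of \<theta> "CARD('d)"]
    by (intro mult_left_mono) auto
  finally show ?thesis .
qed

text \<open>Only the points within distance \<open>\<nu> * h\<close> contribute, and separation bounds their number.\<close>

lemma K_row_sum:
  assumes "P \<subseteq> Y" shows "(\<Sum>y\<in>P. \<bar>K z y\<bar>) \<le> M"
proof -
  have "(\<Sum>y\<in>P. \<bar>K z y\<bar>) \<le> (\<Sum>y\<in>Y. \<bar>K z y\<bar>)"
    using fin assms by (intro sum_mono2) auto
  also have "\<dots> = (\<Sum>y\<in>Y \<inter> cball z (\<nu> * h). \<bar>K z y\<bar>)"
    using fin K_local by (intro sum.mono_neutral_right) (auto simp: dist_norm not_le)
  also have "\<dots> \<le> (\<Sum>y\<in>Y \<inter> cball z (\<nu> * h). K0 / (\<nu> * h) ^ CARD('d))"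
    by (intro sum_mono K_bound)
  also have "\<dots> = K0 / (\<nu> * h) ^ CARD('d) * real (card (Y \<inter> cball z (\<nu> * h)))"
    by simp
  also have "\<dots> \<le> M"
    unfolding M_def
  proof (rule mult_left_mono)
    have "real (card (Y \<inter> cball z (\<nu> * h))) \<le> (1 + \<nu> * h / q) ^ CARD('d)"
      using q_pos pos h_pos by (intro card_inter_cball_le fin sep) auto
    also have "\<dots> \<le> (1 + \<nu> * cq) ^ CARD('d)"
      using hq q_pos pos h_pos by (intro power_mono) (auto simp: field_simps)
    finally show "real (card (Y \<inter> cball z (\<nu> * h))) \<le> (1 + \<nu> * cq) ^ CARD('d)" .
  qed (use K0 pos h_pos in auto)
  finally show ?thesis .
qed

lemma B_row_sum: "x \<in> Y \<Longrightarrow> (\<Sum>y\<in>Y. \<bar>B x y\<bar>) \<le> \<beta>"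
  and B_col_sum: "x \<in> Y \<Longrightarrow> (\<Sum>y\<in>Y. \<bar>B y x\<bar>) \<le> \<beta>"
proof -
  have *: "(\<Sum>y\<in>Y. cA * q ^ CARD('d) * exp (- \<theta> * norm (y - x) / q)) \<le> \<beta>"
    unfolding \<beta>_def sum_distrib_left[symmetric]
    using pos q_pos by (intro mult_left_mono sum_exp_dist_le_decay_sum fin sep) auto
  show "(\<Sum>y\<in>Y. \<bar>B y x\<bar>) \<le> \<beta>" if "x \<in> Y"
    by (rule order.trans[OF sum_mono *]) (use B_decay that in auto)
  show "(\<Sum>y\<in>Y. \<bar>B x y\<bar>) \<le> \<beta>" if "x \<in> Y"
    by (rule order.trans[OF sum_mono *]) (use B_decay that norm_minus_commute[of _ x] in force)
qed

lemma coercive: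
  assumes "P \<subseteq> Y"
  shows "(\<Sum>x\<in>P. (w x)\<^sup>2) \<le> \<beta>\<^sup>2 * M * bilin K P w w"
  by (rule quadratic_form_coercive_subset[OF fin assms quadratic_form_coercive])
    (use fin K_sym K_psd K_row_sum M_pos inv B_row_sum B_col_sum \<beta>_pos in auto)

lemma cardinal_fun_coefficients:
  assumes P: "P \<subseteq> Y"
  obtains b where "cardinal_fun K P x = kernel_comb K P b"
    and "\<And>y. y \<in> P \<Longrightarrow> kernel_comb K P b y = (if y = x then 1 else 0)"
proof -
  have finP: "finite P" using fin P by (rule rev_finite_subset)
  obtain b where "\<forall>y\<in>P. kernel_comb K P b y = (if y = x then 1 else 0)"
    using kernel_system_solvable[where r = "\<lambda>y. if y = x then 1 else 0", OF finP K_sym coercive[OF P]]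
    by blast
  then show ?thesis
    using that[of b] cardinal_fun_eq_kernel_comb[OF finP coercive[OF P], of b x] by auto
qed

lemma continuous_cardinal_fun: "P \<subseteq> Y \<Longrightarrow> continuous_on UNIV (cardinal_fun K P x)"
  by (metis cardinal_fun_coefficients K_comb_cont)

lemma chi_eq_kernel_comb: 
  assumes "x \<in> Y" shows "chi \<Phi> \<nu> \<Omega> Y x = kernel_comb K Y (\<lambda>y. B y x)"
  unfolding chi_def K_def[symmetric]
proof (rule cardinal_fun_eq_kernel_comb[OF fin coercive[OF order.refl]])
  fix y assume "y \<in> Y"
  then show "kernel_comb K Y (\<lambda>y. B y x) y = (if y = x then 1 else 0)"
    using inv assms by (auto simp: is_gram_inverse_def kernel_comb_def mult.commute)
qed

text \<open>The coefficients decay by the Combes-Thomas argument with the weight \<open>\<sigma> * |x - p| / q\<close>; evaluating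
  the kernels moves the argument by at most \<open>\<nu> * h\<close> and costs another factor
  \<open>exp (\<sigma> * (\<nu> * cq))\<close>.\<close>

lemma cardinal_fun_decay:
  assumes P: "P \<subseteq> Y" and p: "p \<in> P"
  shows "\<bar>cardinal_fun K P p z\<bar> \<le> (2 * \<kappa>0\<^sup>2 + 1) * exp (- \<sigma> * norm (p - z) / q)"
proof -
  obtain b where b: "cardinal_fun K P p = kernel_comb K P b"
    "\<And>y. y \<in> P \<Longrightarrow> kernel_comb K P b y = (if y = p then 1 else 0)"
    using cardinal_fun_coefficients[OF P, of p] by metis
  define lam where "lam = 1 / (\<beta>\<^sup>2 * M)"
  have lam: "lam > 0" unfolding lam_def using \<beta>_pos M_pos by simp
  define \<phi> where "\<phi> = (\<lambda>x. \<sigma> * norm (x - p) / q)"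
  have finP: "finite P" using fin P by (rule rev_finite_subset)
  have \<phi>_diff: "\<bar>\<phi> x - \<phi> y\<bar> \<le> \<sigma> * (\<nu> * cq)" if "norm (x - y) \<le> \<nu> * h" for x y
  proof -
    have "\<bar>\<phi> x - \<phi> y\<bar> = \<sigma> / q * \<bar>norm (x - p) - norm (y - p)\<bar>"
      using \<sigma>_pos q_pos by (simp add: \<phi>_def abs_mult flip: diff_divide_distrib right_diff_distrib)
    also have "\<dots> \<le> \<sigma> / q * (\<nu> * h)"
      using norm_triangle_ineq3[of "x - p" "y - p"] that \<sigma>_pos q_pos by (intro mult_left_mono) auto
    also have "\<dots> \<le> \<sigma> / q * (\<nu> * (cq * q))"
      using hq pos \<sigma>_pos q_pos by (intro mult_left_mono) auto
    finally show ?thesis using q_pos by simp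
  qed
  have E: "\<bar>K x y * (exp (\<phi> x - \<phi> y) - 1)\<bar> \<le> \<bar>K x y\<bar> * (1 / (2 * \<kappa>0\<^sup>2))" for x y
  proof (cases "norm (x - y) \<le> \<nu> * h")
    case True
    then have "\<bar>exp (\<phi> x - \<phi> y) - 1\<bar> \<le> 1 / (2 * \<kappa>0\<^sup>2)"
      using abs_exp_minus_1_le[OF \<phi>_diff[OF True]] by (simp add: exp_\<sigma>)
    then show ?thesis by (simp only: abs_mult) (rule mult_left_mono, auto)
  qed (simp add: K_local)
  have "M * (1 / (2 * \<kappa>0\<^sup>2)) \<le> lam / 2"
  proof -
    have "(\<beta> * M)\<^sup>2 \<le> \<kappa>0\<^sup>2"
      using \<beta>_M_le \<beta>_pos M_pos by (intro power_mono) auto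
    then have "M * (\<beta>\<^sup>2 * M) \<le> \<kappa>0\<^sup>2"
      by (simp add: power2_eq_square mult_ac)
    then show ?thesis
      using \<kappa>0_pos \<beta>_pos M_pos by (simp add: lam_def field_simps)
  qed
  then have rows: "(\<Sum>y\<in>P. \<bar>K x y * (exp (\<phi> x - \<phi> y) - 1)\<bar>) \<le> lam / 2" 
    and cols: "(\<Sum>y\<in>P. \<bar>K y x * (exp (\<phi> y - \<phi> x) - 1)\<bar>) \<le> lam / 2" for x
  proof -
    assume le: "M * (1 / (2 * \<kappa>0\<^sup>2)) \<le> lam / 2"
    have *: "(\<Sum>y\<in>P. \<bar>K x y\<bar> * (1 / (2 * \<kappa>0\<^sup>2))) \<le> lam / 2"
      unfolding sum_distrib_right[symmetric]
      by (rule order.trans[OF mult_right_mono[OF K_row_sum[OF P]] le]) simp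
    show "(\<Sum>y\<in>P. \<bar>K x y * (exp (\<phi> x - \<phi> y) - 1)\<bar>) \<le> lam / 2"
      by (rule order.trans[OF sum_mono *]) (rule E)
    show "(\<Sum>y\<in>P. \<bar>K y x * (exp (\<phi> y - \<phi> x) - 1)\<bar>) \<le> lam / 2"
      by (rule order.trans[OF sum_mono *]) (subst K_sym[of x], rule E)
  qed
  have pd: "lam * (\<Sum>x\<in>P. (w x)\<^sup>2) \<le> bilin K P w w" for w
    using coercive[OF P, of w] \<beta>_pos M_pos by (simp add: lam_def field_simps)
  have b_decay: "\<bar>b y\<bar> \<le> 2 / lam * exp (- \<phi> y)" if "y \<in> P" for y
    by (rule combes_thomas[OF finP p pd lam b(2) rows cols _ that]) (auto simp: \<phi>_def)
  have "\<bar>cardinal_fun K P p z\<bar> \<le> (\<Sum>y\<in>P. \<bar>b y\<bar> * \<bar>K z y\<bar>)"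
    unfolding b(1) kernel_comb_def abs_mult[symmetric] by (rule sum_abs)
  also have "\<dots> \<le> (\<Sum>y\<in>P. 2 / lam * (exp (\<sigma> * (\<nu> * cq)) * exp (- \<phi> z)) * \<bar>K z y\<bar>)"
  proof (rule sum_mono)
    fix y assume y: "y \<in> P"
    show "\<bar>b y\<bar> * \<bar>K z y\<bar> \<le> 2 / lam * (exp (\<sigma> * (\<nu> * cq)) * exp (- \<phi> z)) * \<bar>K z y\<bar>"
    proof (cases "norm (z - y) \<le> \<nu> * h")
      case True
      have "\<bar>b y\<bar> \<le> 2 / lam * exp (- \<phi> y)" by (rule b_decay[OF y])
      also have "\<dots> \<le> 2 / lam * (exp (\<sigma> * (\<nu> * cq)) * exp (- \<phi> z))"
        using \<phi>_diff[OF True] lam by (intro mult_left_mono) (auto simp flip: exp_add)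
      finally show ?thesis by (rule mult_right_mono) simp
    qed (simp add: K_local)
  qed
  also have "\<dots> = 2 / lam * (exp (\<sigma> * (\<nu> * cq)) * exp (- \<phi> z)) * (\<Sum>y\<in>P. \<bar>K z y\<bar>)"
    by (simp add: sum_distrib_left)
  also have "\<dots> \<le> 2 / lam * (exp (\<sigma> * (\<nu> * cq)) * exp (- \<phi> z)) * M"
    using lam by (intro mult_left_mono K_row_sum P) auto
  also have "\<dots> = 2 * (\<beta> * M)\<^sup>2 * (exp (\<sigma> * (\<nu> * cq)) * exp (- \<phi> z))"
    by (simp add: lam_def power2_eq_square)
  also have "\<dots> \<le> 2 * \<kappa>0\<^sup>2 * (exp (\<sigma> * (\<nu> * cq)) * exp (- \<phi> z))"
    using \<beta>_M_le \<beta>_pos M_pos by (intro mult_right_mono mult_left_mono power_mono) auto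
  also have "\<dots> = (2 * \<kappa>0\<^sup>2 + 1) * exp (- \<phi> z)"
    unfolding exp_\<sigma> using \<kappa>0_pos by (simp add: field_simps)
  finally show ?thesis
    by (simp add: \<phi>_def norm_minus_commute)
qed

lemma log_ball_mem: "\<rho> \<ge> 0 \<Longrightarrow> x \<in> Y \<Longrightarrow> x \<in> Y \<inter> cball x (log_radius \<Omega> Y \<rho>)"
  using h_pos by (simp add: log_radius_def h_def[symmetric])

lemma chi_lebesgue:
  "(\<Sum>x\<in>Y. \<bar>chi \<Phi> \<nu> \<Omega> Y x z\<bar>) \<le> c\<chi> * decay_sum CARD('d) \<theta>"
proof -
  have "(\<Sum>x\<in>Y. \<bar>chi \<Phi> \<nu> \<Omega> Y x z\<bar>) \<le> (\<Sum>x\<in>Y. c\<chi> * exp (- \<theta> * norm (x - z) / q))"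
    by (intro sum_mono chi_decay)
  also have "\<dots> \<le> c\<chi> * decay_sum CARD('d) \<theta>"
    unfolding sum_distrib_left[symmetric]
    using pos q_pos by (intro mult_left_mono sum_exp_dist_le_decay_sum fin sep) auto
  finally show ?thesis .
qed

lemma local_chi_lebesgue:
  assumes "\<rho> \<ge> 0"
  shows "(\<Sum>x\<in>Y. \<bar>local_chi \<Phi> \<nu> \<Omega> \<rho> Y x z\<bar>) \<le> local_lebesgue CARD('d) \<kappa>0 \<nu> cq"
proof -
  have "(\<Sum>x\<in>Y. \<bar>local_chi \<Phi> \<nu> \<Omega> \<rho> Y x z\<bar>)
      \<le> (\<Sum>x\<in>Y. (2 * \<kappa>0\<^sup>2 + 1) * exp (- \<sigma> * norm (x - z) / q))"
    unfolding local_chi_def K_def[symmetric]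
    by (intro sum_mono cardinal_fun_decay log_ball_mem assms) auto
  also have "\<dots> \<le> local_lebesgue CARD('d) \<kappa>0 \<nu> cq"
    unfolding sum_distrib_left[symmetric] local_lebesgue_def \<sigma>_def[symmetric]
    using \<sigma>_pos q_pos by (intro mult_left_mono sum_exp_dist_le_decay_sum fin sep) auto
  finally show ?thesis .
qed

lemma continuous_chi: "continuous_on UNIV (chi \<Phi> \<nu> \<Omega> Y x)"
  unfolding chi_def K_def[symmetric] by (rule continuous_cardinal_fun) simp

lemma continuous_local_chi: "continuous_on UNIV (local_chi \<Phi> \<nu> \<Omega> \<rho> Y x)"
  unfolding local_chi_def K_def[symmetric] by (rule continuous_cardinal_fun) simp

text \<open>Packing in the ball of radius \<open>R\<close>; two distinct points in it force \<open>q \<le> R\<close>, so that the 1 in the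
  packing bound is absorbed.\<close>

lemma card_le: "real (card Y) \<le> (2 * R * cq) ^ CARD('d) / h ^ CARD('d)"
proof -
  obtain x y where xy: "x \<in> Y" "y \<in> Y" "x \<noteq> y"
    using two fin by (metis card_le_Suc0_iff_eq not_less_eq_eq numeral_2_eq_2)
  have "2 * q \<le> norm (x - y)" by (rule sep[OF xy])
  also have "\<dots> \<le> norm x + norm y" by (rule norm_triangle_ineq4)
  also have "\<dots> \<le> R + R" using xy YR by (intro add_mono) auto
  finally have qR: "q \<le> R" by simp
  have "real (card Y) = real (card (Y \<inter> cball 0 R))"
    using YR by (simp add: Int_absorb2)
  also have "\<dots> \<le> (1 + R / q) ^ CARD('d)"
    using q_pos pos by (intro card_inter_cball_le fin sep) auto
  also have "\<dots> \<le> (2 * R * cq / h) ^ CARD('d)"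
  proof (rule power_mono)
    have "1 + R / q \<le> 2 * R / q" using qR q_pos by (simp add: field_simps)
    also have "\<dots> = 2 * R * cq / (cq * q)" using pos by simp
    also have "\<dots> \<le> 2 * R * cq / h" using hq h_pos pos by (intro divide_left_mono) auto
    finally show "1 + R / q \<le> 2 * R * cq / h" .
  qed (use pos q_pos in auto)
  also have "\<dots> = (2 * R * cq) ^ CARD('d) / h ^ CARD('d)" by (simp add: power_divide)
  finally show ?thesis .
qed

text \<open>With \<open>v\<close> the difference and \<open>w\<close> its coefficients, \<open>|v|\<^sup>2\<close> on \<open>Y\<close> is at most \<open>M * (\<Sum> w y * v y)\<close>, and only the
  points off \<open>P\<close>, where \<open>|w y|\<close> is an entry of \<open>B\<close> beyond the logarithmic radius, contribute. The
  exponential decay over that radius is \<open>exp (- \<theta> * \<rho> * |ln h|) \<le> h powr (\<theta> * \<rho>)\<close>; the loss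
  \<open>h powr (- d)\<close> comes from the number of points.\<close>

lemma chi_localization:
  assumes x: "x \<in> Y" and \<rho>: "\<rho> \<ge> 0"
  shows "\<bar>chi \<Phi> \<nu> \<Omega> Y x z - local_chi \<Phi> \<nu> \<Omega> \<rho> Y x z\<bar>
    \<le> localization_const CARD('d) K0 R \<nu> cq cA c\<chi> \<theta> * h powr (\<theta> * \<rho> - real CARD('d))"
proof -
  define P where "P = Y \<inter> cball x (log_radius \<Omega> Y \<rho>)"
  have P: "P \<subseteq> Y" by (simp add: P_def)
  obtain b where b: "cardinal_fun K P x = kernel_comb K P b"
    "\<And>y. y \<in> P \<Longrightarrow> kernel_comb K P b y = (if y = x then 1 else 0)"
    using cardinal_fun_coefficients[OF P, of x] by metis
  define w where "w = (\<lambda>y. (if y \<in> P then b y else 0) - 1 * B y x)"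
  define v where "v = kernel_comb K Y w"
  have ext: "kernel_comb K Y (\<lambda>y. if y \<in> P then b y else 0) = kernel_comb K P b"
    using fin P unfolding kernel_comb_def
    by (intro ext) (simp add: if_distrib[where f="\<lambda>c. c * _"] sum.inter_restrict[symmetric] Int_absorb1 cong: if_cong)
  have v_eq: "v z = local_chi \<Phi> \<nu> \<Omega> \<rho> Y x z - chi \<Phi> \<nu> \<Omega> Y x z" for z
    unfolding v_def w_def kernel_comb_diff ext chi_eq_kernel_comb[OF x] b(1)[symmetric]
    by (simp add: local_chi_def K_def P_def)
  have chi_Y: "chi \<Phi> \<nu> \<Omega> Y x y = (if y = x then 1 else 0)" if "y \<in> Y" for y
    using inv that x unfolding chi_eq_kernel_comb[OF x]
    by (auto simp: is_gram_inverse_def kernel_comb_def mult.commute)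
  have v_P: "v y = 0" if "y \<in> P" for y
    unfolding v_def w_def kernel_comb_diff ext b(2)[OF that] chi_eq_kernel_comb[OF x, symmetric]
    using chi_Y that P by auto
  \<comment> \<open>The bound for the entries of \<open>B\<close> off \<open>P\<close>. Since \<open>- ln h \<le> \<bar>ln h\<bar>\<close>, the decay over the
    logarithmic radius yields it for \<open>h > 1\<close> as well.\<close>
  define D where "D = cA * q ^ CARD('d) * h powr (\<theta> * \<rho>)"
  have D: "D \<ge> 0" using pos q_pos by (simp add: D_def)
  have B_far: "\<bar>B y x\<bar> \<le> D" if y: "y \<in> Y - P" for y
  proof -
    have far: "\<rho> * h * \<bar>ln h\<bar> \<le> norm (y - x)"
      using y by (auto simp: P_def log_radius_def h_def dist_norm norm_minus_commute)
    have "- ln h * (\<theta> * \<rho>) \<le> \<bar>ln h\<bar> * (\<theta> * \<rho>)"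
      using pos \<rho> by (intro mult_right_mono) auto
    also have "\<dots> = \<theta> * (\<rho> * h * \<bar>ln h\<bar>) / h"
      using h_pos by simp
    also have "\<dots> \<le> \<theta> * norm (y - x) / h"
      using far pos h_pos by (intro divide_right_mono mult_left_mono) auto
    also have "\<dots> \<le> \<theta> * norm (y - x) / q"
      using qh q_pos pos by (intro divide_left_mono) (auto intro!: mult_pos_pos h_pos)
    finally have "exp (- \<theta> * norm (y - x) / q) \<le> exp (\<theta> * \<rho> * ln h)"
      by (simp add: mult_ac)
    also have "\<dots> = h powr (\<theta> * \<rho>)"
      using h_pos by (simp add: powr_def)
    finally have "exp (- \<theta> * norm (y - x) / q) \<le> h powr (\<theta> * \<rho>)" .
    then have "cA * q ^ CARD('d) * exp (- \<theta> * norm (y - x) / q) \<le> D"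
      unfolding D_def using pos q_pos by (intro mult_left_mono) auto
    then show ?thesis using B_decay[of y x] x y by simp
  qed
  let ?V = "\<Sum>y\<in>Y. (v y)\<^sup>2" and ?N = "real (card Y)"
  \<comment> \<open>Testing the energy of \<open>w\<close> against its image: only points off \<open>P\<close> contribute, and there
    the coefficients of the local function vanish.\<close>
  have V: "?V \<le> (M * ?N * D)\<^sup>2"
  proof -
    have "?V \<le> M * bilin K Y w w"
      unfolding v_def by (rule norm_image_le_quadratic_form) (use K_sym K_psd K_row_sum M_pos in auto)
    also have "bilin K Y w w = (\<Sum>y\<in>Y. w y * v y)"
      by (simp add: bilin_kernel_comb v_def)
    also have "M * \<dots> = (\<Sum>y\<in>Y. M * (w y * v y))"
      by (rule sum_distrib_left)
    also have "\<dots> \<le> (\<Sum>y\<in>Y. (v y)\<^sup>2 / 2 + (M * D)\<^sup>2 / 2)"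
    proof (rule sum_mono)
      fix y assume y: "y \<in> Y"
      show "M * (w y * v y) \<le> (v y)\<^sup>2 / 2 + (M * D)\<^sup>2 / 2"
      proof (cases "y \<in> P")
        case False
        then have "\<bar>w y\<bar> \<le> D" using B_far y by (simp add: w_def)
        then have "M * \<bar>w y\<bar> * \<bar>v y\<bar> \<le> M * D * \<bar>v y\<bar>"
          using M_pos by (intro mult_right_mono mult_left_mono) auto
        moreover have "M * (w y * v y) \<le> M * \<bar>w y\<bar> * \<bar>v y\<bar>"
          using M_pos by (simp add: mult.assoc abs_mult[symmetric] mult_left_mono)
        moreover have "2 * (M * D) * \<bar>v y\<bar> \<le> (M * D)\<^sup>2 + \<bar>v y\<bar>\<^sup>2"
          by (rule sum_squares_bound)
        ultimately show ?thesis by simp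
      qed (simp add: v_P)
    qed
    also have "\<dots> = ?V / 2 + ?N * (M * D)\<^sup>2 / 2"
      by (simp add: sum.distrib sum_divide_distrib)
    finally have "?V \<le> ?N * (M * D)\<^sup>2" by simp
    also have "\<dots> \<le> ?N\<^sup>2 * (M * D)\<^sup>2"
      using two by (intro mult_right_mono) (auto simp: power2_eq_square)
    finally show ?thesis by (simp add: power_mult_distrib mult_ac)
  qed
  have v_le: "\<bar>v y\<bar> \<le> M * ?N * D" if "y \<in> Y" for y
  proof -
    have "(v y)\<^sup>2 \<le> ?V" using fin that by (intro member_le_sum) auto
    then have "\<bar>v y\<bar>\<^sup>2 \<le> (M * ?N * D)\<^sup>2" using V by simp
    then show ?thesis by (rule power2_le_imp_le) (use M_pos D in auto)
  qed
  \<comment> \<open>An element of the span is the interpolant of its own values.\<close>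
  have w_eq: "w y = (\<Sum>u\<in>Y. B y u * v u)" if y: "y \<in> Y" for y
  proof -
    have "(\<Sum>u\<in>Y. B y u * v u) = (\<Sum>u\<in>Y. \<Sum>t\<in>Y. B y u * K u t * w t)"
      by (simp add: v_def kernel_comb_def sum_distrib_left mult_ac)
    also have "\<dots> = (\<Sum>t\<in>Y. (\<Sum>u\<in>Y. B y u * K u t) * w t)"
      by (subst sum.swap) (simp add: sum_distrib_right)
    also have "\<dots> = (\<Sum>t\<in>Y. if y = t then w t else 0)"
      using inv y unfolding is_gram_inverse_def by (intro sum.cong refl) simp
    finally show ?thesis using fin y by simp
  qed
  have "v z = (\<Sum>y\<in>Y. \<Sum>u\<in>Y. v u * (B y u * K z y))"
    unfolding v_def[THEN fun_cong, of z] kernel_comb_def[of K Y w]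
    by (intro sum.cong refl) (simp add: w_eq sum_distrib_left mult_ac)
  also have "\<dots> = (\<Sum>u\<in>Y. v u * chi \<Phi> \<nu> \<Omega> Y u z)"
    by (subst sum.swap)
      (simp add: chi_eq_kernel_comb kernel_comb_def sum_distrib_left)
  finally have "\<bar>v z\<bar> \<le> (\<Sum>u\<in>Y. \<bar>v u\<bar> * \<bar>chi \<Phi> \<nu> \<Omega> Y u z\<bar>)"
    by (simp flip: abs_mult)
  also have "\<dots> \<le> (\<Sum>u\<in>Y. M * ?N * D * \<bar>chi \<Phi> \<nu> \<Omega> Y u z\<bar>)"
    by (intro sum_mono mult_right_mono v_le) auto
  also have "\<dots> \<le> M * ?N * D * (c\<chi> * decay_sum CARD('d) \<theta>)"
    unfolding sum_distrib_left[symmetric] using M_pos D by (intro mult_left_mono chi_lebesgue) auto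
  also have "\<dots> = c\<chi> * decay_sum CARD('d) \<theta> * cA * h powr (\<theta> * \<rho>) * ((M * q ^ CARD('d)) * ?N)"
    by (simp add: D_def)
  also have "\<dots> \<le> c\<chi> * decay_sum CARD('d) \<theta> * cA * h powr (\<theta> * \<rho>) *
      (interaction_bound CARD('d) K0 \<nu> cq * ((2 * R * cq) ^ CARD('d) / h ^ CARD('d)))"
    using pos decay_sum_pos[of \<theta> "CARD('d)"] interaction_pos
    by (intro mult_left_mono mult_mono M_q_le card_le) auto
  also have "\<dots> = localization_const CARD('d) K0 R \<nu> cq cA c\<chi> \<theta> * h powr (\<theta> * \<rho> - real CARD('d))"
    using h_pos by (simp add: localization_const_def powr_diff powr_realpow)
  finally show ?thesis
    by (simp add: v_eq abs_minus_commute)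
qed

end


section \<open>Perturbed multiscale iterations\<close>

lemma abs_expansion_le:
  assumes "(\<Sum>x\<in>S. \<bar>b x y\<bar>) \<le> \<Lambda>" and "\<And>x. x \<in> S \<Longrightarrow> \<bar>e x\<bar> \<le> A" and "A \<ge> 0"
  shows "\<bar>expansion b S e y\<bar> \<le> A * \<Lambda>"
proof -
  have "\<bar>expansion b S e y\<bar> \<le> (\<Sum>x\<in>S. \<bar>e x\<bar> * \<bar>b x y\<bar>)"
    unfolding expansion_def abs_mult[symmetric] by (rule sum_abs)
  also have "\<dots> \<le> (\<Sum>x\<in>S. A * \<bar>b x y\<bar>)"
    by (intro sum_mono mult_right_mono assms(2)) auto
  also have "\<dots> \<le> A * \<Lambda>"
    unfolding sum_distrib_left[symmetric] using assms by (intro mult_left_mono) auto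
  finally show ?thesis .
qed

text \<open>The comparison of the two iterations uses nothing but these bounds: \<open>\<Lambda>\<close> for both families of
  basis functions and \<open>T\<close> for the sum of their distances.\<close>

locale perturbed_iteration =
  fixes b b' :: "nat \<Rightarrow> 'a \<Rightarrow> 'a \<Rightarrow> real" and S :: "nat \<Rightarrow> 'a set"
    and e e' :: "nat \<Rightarrow> 'a \<Rightarrow> real" and s L :: nat and \<Lambda> :: real and T :: "nat \<Rightarrow> real"
    and U :: "nat \<Rightarrow> 'a set" and E :: "nat \<Rightarrow> real"
  defines "U \<equiv> \<lambda>l. \<Union>j\<in>{s + 1..l}. S j" and "E \<equiv> \<lambda>l. linf_norm (U l) (e s)"
  assumes finite_S: "\<And>l. s < l \<Longrightarrow> l \<le> L \<Longrightarrow> finite (S l)"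
    and lebesgue: "\<And>l y. s < l \<Longrightarrow> l \<le> L \<Longrightarrow> (\<Sum>x\<in>S l. \<bar>b l x y\<bar>) \<le> \<Lambda>"
    and lebesgue': "\<And>l y. s < l \<Longrightarrow> l \<le> L \<Longrightarrow> (\<Sum>x\<in>S l. \<bar>b' l x y\<bar>) \<le> \<Lambda>"
    and close: "\<And>l y. s < l \<Longrightarrow> l \<le> L \<Longrightarrow> (\<Sum>x\<in>S l. \<bar>b l x y - b' l x y\<bar>) \<le> T l"
    and \<Lambda>_nonneg: "\<Lambda> \<ge> 0"
    and start: "e' s = e s"
    and error_step: "\<And>n y. s \<le> n \<Longrightarrow> n < L \<Longrightarrow> e (Suc n) y = e n y - expansion (b (Suc n)) (S (Suc n)) (e n) y"
    and error_step': "\<And>n y. s \<le> n \<Longrightarrow> n < L \<Longrightarrow> e' (Suc n) y = e' n y - expansion (b' (Suc n)) (S (Suc n)) (e' n) y"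
begin

lemma finite_U: "l \<le> L \<Longrightarrow> finite (U l)"
  unfolding U_def by (auto intro: finite_S)

lemma E_nonneg: "l \<le> L \<Longrightarrow> E l \<ge> 0"
  unfolding E_def by (rule linf_norm_nonneg[OF finite_U])

lemma E_mono: "l \<le> m \<Longrightarrow> m \<le> L \<Longrightarrow> E l \<le> E m"
  unfolding E_def by (rule linf_norm_mono[OF finite_U], assumption, unfold U_def, rule UN_mono) auto

lemma T_nonneg: "s < l \<Longrightarrow> l \<le> L \<Longrightarrow> T l \<ge> 0"
  by (rule order.trans[OF sum_nonneg close]) auto

text \<open>Every value sampled before level \<open>l\<close> is taken in \<open>U l\<close>, so a step changes the error there by at most
  \<open>\<Lambda>\<close> times its maximum over \<open>U l\<close>.\<close>

lemma growth:
  assumes "s \<le> n" "n \<le> l" "l \<le> L" "x \<in> U l"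
  shows "\<bar>e n x\<bar> \<le> (1 + \<Lambda>) ^ (n - s) * E l"
  using assms(1,2,4)
proof (induction n arbitrary: x rule: dec_induct)
  case base
  then show ?case
    unfolding E_def using assms(3) by (simp add: abs_le_linf_norm finite_U)
next
  case (step n)
  let ?A = "(1 + \<Lambda>) ^ (n - s) * E l"
  have A: "?A \<ge> 0"
    using \<Lambda>_nonneg E_nonneg[OF assms(3)] by simp
  have "S (Suc n) \<subseteq> U l"
    unfolding U_def using step by (auto intro!: bexI[of _ "Suc n"])
  then have "\<bar>expansion (b (Suc n)) (S (Suc n)) (e n) x\<bar> \<le> ?A * \<Lambda>"
    using step assms(3) A by (intro abs_expansion_le lebesgue) auto
  moreover have "\<bar>e n x\<bar> \<le> ?A"
    using step by auto
  moreover have "e (Suc n) x = e n x - expansion (b (Suc n)) (S (Suc n)) (e n) x"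
    using step assms(3) by (intro error_step) auto
  ultimately have "\<bar>e (Suc n) x\<bar> \<le> ?A + ?A * \<Lambda>"
    by linarith
  also have "\<dots> = (1 + \<Lambda>) ^ (Suc n - s) * E l"
    using step by (simp add: Suc_diff_le algebra_simps)
  finally show ?case .
qed

text \<open>The sampled error is taken from the first iteration in the term with the difference of the basis
  functions: for it the growth bound is available.\<close>

lemma step_difference:
  assumes l: "s < l" "l \<le> L" and A: "\<And>x. x \<in> S l \<Longrightarrow> \<bar>e' (l - 1) x - e (l - 1) x\<bar> \<le> A" "A \<ge> 0"
  shows "\<bar>expansion (b l) (S l) (e (l - 1)) y - expansion (b' l) (S l) (e' (l - 1)) y\<bar>
    \<le> (1 + \<Lambda>) ^ (l - s - 1) * E l * T l + \<Lambda> * A"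
proof -
  let ?F = "expansion (\<lambda>x y. b l x y - b' l x y) (S l) (e (l - 1)) y"
  let ?G = "expansion (b' l) (S l) (\<lambda>x. e' (l - 1) x - e (l - 1) x) y"
  have "expansion (b l) (S l) (e (l - 1)) y - expansion (b' l) (S l) (e' (l - 1)) y = ?F - ?G"
    by (simp add: expansion_def sum_subtractf[symmetric] algebra_simps)
  moreover have "\<bar>?G\<bar> \<le> A * \<Lambda>"
    by (rule abs_expansion_le[OF lebesgue'[OF l] A])
  moreover have "\<bar>?F\<bar> \<le> (1 + \<Lambda>) ^ (l - s - 1) * E l * T l"
  proof (rule abs_expansion_le[OF close[OF l]])
    have sub: "S l \<subseteq> U l"
      unfolding U_def using l by (auto intro!: bexI[of _ l])
    show "\<bar>e (l - 1) x\<bar> \<le> (1 + \<Lambda>) ^ (l - s - 1) * E l" if "x \<in> S l" for x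
      using growth[of "l - 1" l x] l sub that by (auto simp: diff_diff_add add.commute)
    show "0 \<le> (1 + \<Lambda>) ^ (l - s - 1) * E l"
      using \<Lambda>_nonneg E_nonneg[OF l(2)] by simp
  qed
  ultimately show ?thesis by (simp add: mult.commute) linarith
qed

text \<open>The factor \<open>1 + \<Lambda>\<close> on the left stands for the exponent \<open>l - s - 1\<close> on the right and makes the
  statement meaningful at \<open>l = s\<close>, where both sides vanish.\<close>

lemma error_difference:
  assumes "s \<le> l" "l \<le> L"
  shows "(1 + \<Lambda>) * \<bar>e l y - e' l y\<bar> \<le> (1 + \<Lambda>) ^ (l - s) * E l * (\<Sum>j\<in>{s<..l}. T j)"
  using assms
proof (induction l arbitrary: y rule: dec_induct)
  case base
  then show ?case by (simp add: start)
next
  case (step n)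
  define A where "A = (1 + \<Lambda>) ^ (n - s) * E n * (\<Sum>j\<in>{s<..n}. T j) / (1 + \<Lambda>)"
  have nL: "s \<le> n" "n < L" using step by auto
  have nn: "(\<Sum>j\<in>{s<..n}. T j) \<ge> 0"
    using nL by (intro sum_nonneg T_nonneg) auto
  have A_bound: "\<bar>e n x - e' n x\<bar> \<le> A" for x
    using step.IH[of x] nL \<Lambda>_nonneg by (simp add: A_def pos_le_divide_eq mult.commute)
  have A0: "A \<ge> 0" using order.trans[OF abs_ge_zero A_bound] .
  let ?D = "\<bar>expansion (b (Suc n)) (S (Suc n)) (e n) y - expansion (b' (Suc n)) (S (Suc n)) (e' n) y\<bar>"
  have D: "?D \<le> (1 + \<Lambda>) ^ (n - s) * E (Suc n) * T (Suc n) + \<Lambda> * A"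
    using step_difference[of "Suc n" A y] nL A_bound A0 by (simp add: abs_minus_commute)
  have "\<bar>e (Suc n) y - e' (Suc n) y\<bar> \<le> \<bar>e n y - e' n y\<bar> + ?D"
    unfolding error_step[OF nL] error_step'[OF nL] by linarith
  also have "\<dots> \<le> A + ((1 + \<Lambda>) ^ (n - s) * E (Suc n) * T (Suc n) + \<Lambda> * A)"
    by (intro add_mono A_bound D)
  also have "\<dots> = (1 + \<Lambda>) * A + (1 + \<Lambda>) ^ (n - s) * E (Suc n) * T (Suc n)"
    by (simp add: algebra_simps)
  also have "(1 + \<Lambda>) * A = (1 + \<Lambda>) ^ (n - s) * E n * (\<Sum>j\<in>{s<..n}. T j)"
    using \<Lambda>_nonneg by (simp add: A_def)
  also have "\<dots> \<le> (1 + \<Lambda>) ^ (n - s) * E (Suc n) * (\<Sum>j\<in>{s<..n}. T j)"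
    using \<Lambda>_nonneg nL nn by (intro mult_right_mono mult_left_mono E_mono) auto
  finally have "\<bar>e (Suc n) y - e' (Suc n) y\<bar>
      \<le> (1 + \<Lambda>) ^ (n - s) * E (Suc n) * ((\<Sum>j\<in>{s<..n}. T j) + T (Suc n))"
    by (simp add: algebra_simps)
  also have "(\<Sum>j\<in>{s<..n}. T j) + T (Suc n) = (\<Sum>j\<in>{s<..Suc n}. T j)"
  proof -
    have "{s<..Suc n} = insert (Suc n) {s<..n}" using nL by auto
    then show ?thesis by simp
  qed
  finally have "(1 + \<Lambda>) * \<bar>e (Suc n) y - e' (Suc n) y\<bar>
      \<le> (1 + \<Lambda>) * ((1 + \<Lambda>) ^ (n - s) * E (Suc n) * (\<Sum>j\<in>{s<..Suc n}. T j))"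
    using \<Lambda>_nonneg by (intro mult_left_mono) auto
  also have "\<dots> = (1 + \<Lambda>) ^ (Suc n - s) * E (Suc n) * (\<Sum>j\<in>{s<..Suc n}. T j)"
    using nL by (simp add: Suc_diff_le)
  finally show ?case .
qed

end

lemma sum_powr_geometric_le:
  fixes h :: "nat \<Rightarrow> real"
  assumes a: "a > 0" and \<mu>: "0 < \<mu>" "\<mu> < 1" and "s < l"
    and pos: "\<And>j. s < j \<Longrightarrow> j \<le> l \<Longrightarrow> 0 < h j"
    and dec: "\<And>j. s < j \<Longrightarrow> j < l \<Longrightarrow> h (Suc j) \<le> \<mu> * h j"
  shows "(\<Sum>j\<in>{s<..l}. h j powr a) \<le> h (Suc s) powr a / (1 - \<mu> powr a)"
proof -
  have \<mu>a: "0 < \<mu> powr a" "\<mu> powr a < 1"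
    using \<mu> a powr_less_mono2[of a \<mu> 1] by auto
  have step: "h (Suc s + i) powr a \<le> (\<mu> powr a) ^ i * h (Suc s) powr a" if "Suc s + i \<le> l" for i
    using that
  proof (induction i)
    case (Suc i)
    have "h (Suc s + Suc i) powr a \<le> (\<mu> * h (Suc s + i)) powr a"
      using Suc.prems a pos[of "Suc s + Suc i"] dec[of "Suc s + i"] by (intro powr_mono2) auto
    also have "\<dots> = \<mu> powr a * h (Suc s + i) powr a"
      using \<mu> pos[of "Suc s + i"] Suc.prems by (simp add: powr_mult)
    also have "\<dots> \<le> \<mu> powr a * ((\<mu> powr a) ^ i * h (Suc s) powr a)"
      using Suc by (intro mult_left_mono) auto
    finally show ?case by simp
  qed simp
  have "(\<Sum>j\<in>{s<..l}. h j powr a) = (\<Sum>i<l - s. h (Suc s + i) powr a)"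
    by (rule sum.reindex_bij_witness[of _ "\<lambda>i. Suc s + i" "\<lambda>j. j - Suc s"]) auto
  also have "\<dots> \<le> (\<Sum>i<l - s. (\<mu> powr a) ^ i * h (Suc s) powr a)"
    by (intro sum_mono step) auto
  also have "\<dots> = h (Suc s) powr a * ((1 - (\<mu> powr a) ^ (l - s)) / (1 - \<mu> powr a))"
    using \<mu>a by (simp add: sum_distrib_right[symmetric] sum_gp_strict mult.commute)
  also have "\<dots> \<le> h (Suc s) powr a * (1 / (1 - \<mu> powr a))"
    using \<mu>a by (intro mult_left_mono divide_right_mono) auto
  finally show ?thesis by simp
qed


section \<open>Admissible kernels and point sequences\<close>

lemma admissible_kernelD:
  fixes \<Phi> :: "real^'d \<Rightarrow> real"
  assumes "admissible_kernel \<tau> c\<Phi> C\<Phi> \<Phi>"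
  shows "continuous_on UNIV \<Phi>" and "integrable lborel \<Phi>" and "c\<Phi> > 0"
    and "\<And>x. \<Phi> (- x) = \<Phi> x"
    and "closure {x. \<Phi> x \<noteq> 0} \<subseteq> cball 0 1"
    and "\<And>\<omega>. c\<Phi> * (1 + (norm \<omega>)\<^sup>2) powr (- \<tau>) \<le> Re (fourier \<Phi> \<omega>)"
proof -
  note A = assms[unfolded admissible_kernel_def]
  show "continuous_on UNIV \<Phi>" "integrable lborel \<Phi>" "c\<Phi> > 0"
    "closure {x. \<Phi> x \<noteq> 0} \<subseteq> cball 0 1"
    "\<And>\<omega>. c\<Phi> * (1 + (norm \<omega>)\<^sup>2) powr (- \<tau>) \<le> Re (fourier \<Phi> \<omega>)"
    using A by blast+
  have radial: "\<forall>x y. norm x = norm y \<longrightarrow> \<Phi> x = \<Phi> y" using A by blast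
  show "\<Phi> (- x) = \<Phi> x" for x
    by (rule radial[rule_format]) simp
qed

lemma admissible_kernel_zero_outside:
  fixes \<Phi> :: "real^'d \<Rightarrow> real"
  assumes "admissible_kernel \<tau> c\<Phi> C\<Phi> \<Phi>" and "norm x > 1"
  shows "\<Phi> x = 0"
proof (rule ccontr)
  assume "\<Phi> x \<noteq> 0"
  then have "x \<in> cball 0 1"
    by (intro subsetD[OF admissible_kernelD(5)[OF assms(1)]] subsetD[OF closure_subset]) simp
  then show False using assms(2) by simp
qed

text \<open>By compactness of the unit ball, outside of which the kernel vanishes.\<close>

lemma admissible_kernel_bounded:
  fixes \<Phi> :: "real^'d \<Rightarrow> real"
  assumes "admissible_kernel \<tau> c\<Phi> C\<Phi> \<Phi>"
  obtains K0 where "K0 > 0" and "\<And>x. \<bar>\<Phi> x\<bar> \<le> K0"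
proof -
  have cont: "continuous_on (cball 0 1) \<Phi>"
    using admissible_kernelD(1)[OF assms] by (rule continuous_on_subset) simp
  have "bounded (\<Phi> ` cball 0 1)"
    by (intro compact_imp_bounded compact_continuous_image cont compact_cball)
  then obtain C where C: "C > 0" "\<And>x. x \<in> cball 0 1 \<Longrightarrow> \<bar>\<Phi> x\<bar> \<le> C"
    unfolding bounded_pos by auto
  have "\<bar>\<Phi> x\<bar> \<le> C" for x
  proof (cases "norm x > 1")
    case True
    then show ?thesis using admissible_kernel_zero_outside[OF assms] C(1) by simp
  qed (use C(2) in simp)
  then show ?thesis using that C(1) by blast
qed

lemma admissible_kernel_psd:
  fixes \<Phi> :: "real^'d \<Rightarrow> real"
  assumes adm: "admissible_kernel \<tau> c\<Phi> C\<Phi> \<Phi>"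
  shows "0 \<le> (\<Sum>x\<in>I. \<Sum>y\<in>I. a x * a y * \<Phi> (p x - p y))"
proof -
  obtain K0 where K0: "\<And>x. \<bar>\<Phi> x\<bar> \<le> K0" by (rule admissible_kernel_bounded[OF adm]) blast
  have int: "integrable lborel \<Phi>" and cont: "continuous_on UNIV \<Phi>"
    using admissible_kernelD[OF adm] by blast+
  have [measurable]: "\<Phi> \<in> borel_measurable borel" using int by auto
  show ?thesis
  proof (rule continuous_psd_of_nonneg_fourier[OF cont int K0])
    fix \<omega>
    have "integrable lborel (\<lambda>x. \<Phi> x *\<^sub>R cis (- (x \<bullet> \<omega>)))"
      by (rule Bochner_Integration.integrable_bound[OF int])
        (auto intro!: borel_measurable_continuous_onI continuous_intros cont)
    from integral_Re[OF this] have re: "Re (LINT x|lborel. \<Phi> x *\<^sub>R cis (- (x \<bullet> \<omega>))) = (LINT x|lborel. \<Phi> x * cos (x \<bullet> \<omega>))"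
      by simp
    have "0 \<le> c\<Phi> * (1 + (norm \<omega>)\<^sup>2) powr (- \<tau>)"
      using admissible_kernelD(3)[OF adm] by simp
    also have "\<dots> \<le> Re (fourier \<Phi> \<omega>)"
      by (rule admissible_kernelD(6)[OF adm])
    also have "\<dots> = (2 * pi) powr (- real CARD('d) / 2) * (LINT x|lborel. \<Phi> x * cos (x \<bullet> \<omega>))"
      by (simp add: fourier_def re)
    finally show "0 \<le> (LINT x|lborel. \<Phi> x * cos (x \<bullet> \<omega>))"
      by (simp add: zero_le_mult_iff)
  qed
qed

lemma admissible_pointsD:
  fixes X :: "nat \<Rightarrow> (real^'d) set"
  assumes "admissible_points \<Omega> \<mu> ch cq cn \<gamma> \<nu> X L"
  shows "\<And>l. 1 \<le> l \<Longrightarrow> finite (X l)" and "\<And>l. 1 \<le> l \<Longrightarrow> 2 \<le> card (X l)" and "\<And>l. 1 \<le> l \<Longrightarrow> X l \<subseteq> \<Omega>"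
    and "\<And>l. l \<in> {1..L} \<Longrightarrow> fill_dist \<Omega> (X (l + 1)) \<le> \<mu> * fill_dist \<Omega> (X l)"
    and "\<And>l. l \<in> {1..L} \<Longrightarrow> ch * \<mu> ^ l * (fill_dist \<Omega> (X 1) / \<mu>) \<le> fill_dist \<Omega> (X l)"
    and "\<And>l. l \<in> {1..L} \<Longrightarrow> sep_dist (X l) \<le> fill_dist \<Omega> (X l)"
    and "\<And>l. l \<in> {1..L} \<Longrightarrow> fill_dist \<Omega> (X l) \<le> cq * sep_dist (X l)"
    and "1 / fill_dist \<Omega> (X 1) \<le> \<nu>"
  using assms unfolding admissible_points_def Let_def by blast+

lemma fill_dist_pos:
  fixes X :: "nat \<Rightarrow> (real^'d) set"
  assumes adm: "admissible_points \<Omega> \<mu> ch cq cn \<gamma> \<nu> X L" and l: "l \<in> {1..L}"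
  shows "fill_dist \<Omega> (X l) > 0"
  using sep_dist_pos(1)[of "X l"] admissible_pointsD(1,2)[OF adm, of l] admissible_pointsD(6)[OF adm l] l
  by auto

lemma cardinal_level_of_admissible:
  fixes \<Phi> :: "real^'d \<Rightarrow> real"
  assumes ker: "admissible_kernel \<tau> c\<Phi> C\<Phi> \<Phi>" and K0: "K0 > 0" "\<And>x. \<bar>\<Phi> x\<bar> \<le> K0"
    and R: "R > 0" "\<Omega> \<subseteq> cball 0 R"
    and pos: "\<nu> > 0" "cq > 0" "cA > 0" "c\<chi> > 0" "\<theta> > 0"
    and adm: "admissible_points \<Omega> \<mu> ch cq cn \<gamma> \<nu> X L"
    and dec: "decay_bounds \<Phi> \<nu> \<Omega> \<theta> cA c\<chi> X L" and l: "l \<in> {1..L}"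
  obtains B where "cardinal_level \<Phi> \<Omega> (X l) K0 R \<nu> cq cA c\<chi> \<theta> B"
proof -
  obtain B where B: "is_gram_inverse (level_kernel \<Phi> \<nu> \<Omega> (X l)) (X l) B"
    "\<And>x y. x \<in> X l \<Longrightarrow> y \<in> X l \<Longrightarrow> \<bar>B x y\<bar> \<le>
       cA * sep_dist (X l) ^ CARD('d) * exp (- \<theta> * norm (x - y) / sep_dist (X l))"
    using dec l unfolding decay_bounds_def by blast
  have chi: "\<And>x y. x \<in> X l \<Longrightarrow> \<bar>chi \<Phi> \<nu> \<Omega> (X l) x y\<bar> \<le> c\<chi> * exp (- \<theta> * norm (x - y) / sep_dist (X l))"
    using dec l unfolding decay_bounds_def by blast
  have "1 \<le> l" using l by simp
  note D = admissible_pointsD[OF adm]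
  have "cardinal_level \<Phi> \<Omega> (X l) K0 R \<nu> cq cA c\<chi> \<theta> B"
    by (rule cardinal_level.intro)
      (rule admissible_kernelD[OF ker] admissible_kernel_psd[OF ker] K0 R pos B chi
        admissible_kernel_zero_outside[OF ker] D(1,2)[OF \<open>1 \<le> l\<close>] order.trans[OF D(3)[OF \<open>1 \<le> l\<close>] R(2)]
        D(6,7)[OF l] | assumption)+
  then show ?thesis by (rule that)
qed

text \<open>\<open>h\<^sub>l\<close> is at least a multiple of \<open>\<mu> ^ l * h\<^sub>1\<close>, and the bound \<open>1 / h\<^sub>1 \<le> \<nu>\<close> removes \<open>h\<^sub>1\<close> from the constant.\<close>

lemma inverse_fill_dist_power_le:
  fixes X :: "nat \<Rightarrow> (real^'d) set"
  assumes adm: "admissible_points \<Omega> \<mu> ch cq cn \<gamma> \<nu> X L" and l: "l \<in> {1..L}"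
    and pos: "0 < \<mu>" "0 < ch" "0 < \<nu>"
  shows "1 / fill_dist \<Omega> (X l) ^ CARD('d) \<le> (\<nu> * \<mu> / ch) ^ CARD('d) * \<mu> powr (- real (CARD('d) * l))"
proof -
  have h1: "fill_dist \<Omega> (X 1) > 0" using fill_dist_pos[OF adm, of 1] l by simp
  have "1 / \<nu> \<le> fill_dist \<Omega> (X 1)"
    using admissible_pointsD(8)[OF adm] h1 pos by (simp add: field_simps)
  then have "ch * \<mu> ^ l * (1 / \<nu> / \<mu>) \<le> ch * \<mu> ^ l * (fill_dist \<Omega> (X 1) / \<mu>)"
    using pos by (intro mult_left_mono divide_right_mono) auto
  also have "\<dots> \<le> fill_dist \<Omega> (X l)" by (rule admissible_pointsD(5)[OF adm l])
  finally have "1 / fill_dist \<Omega> (X l) \<le> 1 / (ch * \<mu> ^ l * (1 / \<nu> / \<mu>))"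
    using pos by (intro divide_left_mono mult_pos_pos fill_dist_pos[OF adm l]) auto
  also have "\<dots> = \<nu> * \<mu> / ch * (1 / \<mu> ^ l)"
    using pos by (simp add: field_simps)
  finally have "(1 / fill_dist \<Omega> (X l)) ^ CARD('d) \<le> (\<nu> * \<mu> / ch * (1 / \<mu> ^ l)) ^ CARD('d)"
    using fill_dist_pos[OF adm l] by (intro power_mono) auto
  also have "\<dots> = (\<nu> * \<mu> / ch) ^ CARD('d) * (1 / \<mu> ^ (CARD('d) * l))"
    by (simp only: power_mult_distrib power_one_over power_mult[symmetric] mult.commute[of l])
  also have "1 / \<mu> ^ (CARD('d) * l) = \<mu> powr (- real (CARD('d) * l))"
    using pos by (simp only: powr_minus powr_realpow inverse_eq_divide)
  finally show ?thesis by (simp only: power_one_over)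
qed

lemma adapt_err_initial:
  "n \<le> start_level k \<mu> \<Longrightarrow> adapt_err \<Phi> \<nu> \<Omega> X k \<mu> \<kappa> \<epsilon> L f n = class_err \<Phi> \<nu> \<Omega> X f (start_level k \<mu>)"
  by (cases n) auto

lemma local_err_initial:
  "n \<le> start_level k \<mu> \<Longrightarrow> local_err \<Phi> \<nu> \<Omega> X k \<mu> \<kappa> \<rho> \<epsilon> L f n = class_err \<Phi> \<nu> \<Omega> X f (start_level k \<mu>)"
  by (cases n) auto

lemma adapt_err_step:
  "start_level k \<mu> \<le> n \<Longrightarrow> adapt_err \<Phi> \<nu> \<Omega> X k \<mu> \<kappa> \<epsilon> L f (Suc n) y = adapt_err \<Phi> \<nu> \<Omega> X k \<mu> \<kappa> \<epsilon> L f n y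
     - expansion (chi \<Phi> \<nu> \<Omega> (X (Suc n))) (adapt_points \<Phi> \<nu> \<Omega> X k \<mu> \<kappa> \<epsilon> L f (Suc n))
         (adapt_err \<Phi> \<nu> \<Omega> X k \<mu> \<kappa> \<epsilon> L f n) y"
  by (simp add: adapt_points_def)

lemma local_err_step:
  "start_level k \<mu> \<le> n \<Longrightarrow> local_err \<Phi> \<nu> \<Omega> X k \<mu> \<kappa> \<rho> \<epsilon> L f (Suc n) y = local_err \<Phi> \<nu> \<Omega> X k \<mu> \<kappa> \<rho> \<epsilon> L f n y
     - expansion (local_chi \<Phi> \<nu> \<Omega> \<rho> (X (Suc n))) (adapt_points \<Phi> \<nu> \<Omega> X k \<mu> \<kappa> \<epsilon> L f (Suc n))
         (local_err \<Phi> \<nu> \<Omega> X k \<mu> \<kappa> \<rho> \<epsilon> L f n) y"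
  by simp

lemma continuous_expansion:
  "(\<And>x. continuous_on A (b x)) \<Longrightarrow> continuous_on A (expansion b S e)"
  unfolding expansion_def by (intro continuous_intros)


section \<open>Comparison of the adaptive iterations\<close>

theorem theorem24:
  fixes \<Phi> :: "real^'d \<Rightarrow> real" and \<Omega> :: "(real^'d) set"
    and \<tau> c\<Phi> C\<Phi> k \<mu> ch cq cn \<gamma> \<nu> \<theta> Cd Md cA c\<chi> \<kappa> \<rho> :: real
  assumes "bounded_lipschitz_domain \<Omega>"
    and "admissible_kernel \<tau> c\<Phi> C\<Phi> \<Phi>"
    and "k > 1" and "0 < \<mu>" and "\<mu> < 1 / k"
    and "0 < ch" and "ch \<le> 1" and "cq > 0" and "cn > 0" and "\<gamma> > 0"
    and "\<theta> > 0" and "Cd > 0" and "Md > 0"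
    and "cA = 2 / (Cd * c\<Phi>) * (1 + 4 * Md\<^sup>2 * \<nu>\<^sup>2 * cq\<^sup>2) powr \<tau> * exp (2 * \<theta> * sqrt (real CARD('d)))"
    and "c\<chi> = cA * exp (cq * \<nu> * \<theta>) * (1 + \<nu> * cq) ^ CARD('d)"
    and "\<kappa> > 0" and "0 < \<rho>" and "\<rho> < k * \<kappa>"
  shows "\<exists>\<Lambda> > 0. \<exists>c > 0. \<exists>Cn > 0. \<forall>X L.
    admissible_points \<Omega> \<mu> ch cq cn \<gamma> \<nu> X L \<and> decay_bounds \<Phi> \<nu> \<Omega> \<theta> cA c\<chi> X L \<longrightarrow>
    (\<forall>l \<in> {1..L}.
       (\<forall>y. (\<Sum>x\<in>X l. \<bar>chi \<Phi> \<nu> \<Omega> (X l) x y\<bar>) \<le> \<Lambda>) \<and>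
       (\<forall>x \<in> X l. Linf_norm \<Omega> (\<lambda>y. chi \<Phi> \<nu> \<Omega> (X l) x y - local_chi \<Phi> \<nu> \<Omega> \<rho> (X l) x y)
          \<le> ereal (c * fill_dist \<Omega> (X l) powr (\<theta> * \<rho> - real CARD('d)))) \<and>
       real (card (X l)) \<le> Cn * \<mu> powr (- real (CARD('d) * l))) \<and>
    (\<forall>f \<epsilon>. continuous_on \<Omega> f \<and> (\<forall>l. \<epsilon> l > 0) \<longrightarrow>
      (\<forall>l. start_level k \<mu> < l \<and> l \<le> L \<longrightarrow>
        Linf_norm \<Omega> (\<lambda>y. adapt_step \<Phi> \<nu> \<Omega> X k \<mu> \<kappa> \<epsilon> L f l y - local_step \<Phi> \<nu> \<Omega> X k \<mu> \<kappa> \<rho> \<epsilon> L f l y)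
          \<le> ereal ((1 + \<Lambda>) ^ (l - start_level k \<mu> - 1)
               * linf_norm (adapt_points_upto \<Phi> \<nu> \<Omega> X k \<mu> \<kappa> \<epsilon> L f l) (class_err \<Phi> \<nu> \<Omega> X f (start_level k \<mu>))
               * c * Cn * fill_dist \<Omega> (X l) powr (\<theta> * \<rho> - 2 * real CARD('d)))
            + ereal \<Lambda> * Linf_norm \<Omega> (\<lambda>y. local_err \<Phi> \<nu> \<Omega> X k \<mu> \<kappa> \<rho> \<epsilon> L f (l - 1) y
                                         - adapt_err \<Phi> \<nu> \<Omega> X k \<mu> \<kappa> \<epsilon> L f (l - 1) y) \<and>
        (\<theta> * \<rho> > 2 * real CARD('d) \<longrightarrow>
          Linf_norm \<Omega> (\<lambda>y. adapt_err \<Phi> \<nu> \<Omega> X k \<mu> \<kappa> \<epsilon> L f l y - local_err \<Phi> \<nu> \<Omega> X k \<mu> \<kappa> \<rho> \<epsilon> L f l y)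
            \<le> ereal (c * Cn * (1 + \<Lambda>) ^ (l - start_level k \<mu> - 1)
                 * linf_norm (adapt_points_upto \<Phi> \<nu> \<Omega> X k \<mu> \<kappa> \<epsilon> L f l) (class_err \<Phi> \<nu> \<Omega> X f (start_level k \<mu>))
                 * (2 * ch * fill_dist \<Omega> (X (start_level k \<mu> + 1)) powr (\<theta> * \<rho> - 2 * real CARD('d)))))))"
proof (cases "\<nu> > 0")
  case False
  \<comment> \<open>Then no point sequence with at least one level is admissible, and without levels
    nothing is claimed.\<close>
  have no_level: "L = 0" if "admissible_points \<Omega> \<mu> ch cq cn \<gamma> \<nu> X L" for X L
  proof (rule ccontr)
    assume "L \<noteq> 0"
    then have "fill_dist \<Omega> (X 1) > 0" using fill_dist_pos[OF that, of 1] by simp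
    then have "1 / fill_dist \<Omega> (X 1) > 0" by simp
    with admissible_pointsD(8)[OF that] False show False by linarith
  qed
  then show ?thesis
    by (intro exI[of _ "1::real"] conjI zero_less_one allI impI) (auto dest!: no_level)
next
  case \<nu>: True
  let ?d = "CARD('d)" and ?s = "start_level k \<mu>" and ?a = "\<theta> * \<rho> - 2 * real CARD('d)"
  have ker: "admissible_kernel \<tau> c\<Phi> C\<Phi> \<Phi>" and pos: "0 < \<mu>" "0 < ch" "cq > 0" "\<theta> > 0" and \<rho>: "\<rho> \<ge> 0"
    using assms by auto
  have \<mu>1: "\<mu> < 1"
  proof -
    have "1 / k < 1" using assms(3) by simp
    then show ?thesis using assms(5) by linarith
  qed
  have \<Omega>: "open \<Omega>" "\<Omega> \<noteq> {}" "bounded \<Omega>"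
    using assms(1) by (auto simp: bounded_lipschitz_domain_def)
  obtain K0 where K0: "K0 > 0" "\<And>x. \<bar>\<Phi> x\<bar> \<le> K0"
    using admissible_kernel_bounded[OF ker] by blast
  obtain R where R: "R > 0" "\<Omega> \<subseteq> cball 0 R"
    using \<Omega>(3) unfolding bounded_pos by (auto simp: subset_iff)
  have cA: "cA > 0"
    using admissible_kernelD(3)[OF ker] assms(12) pos
    by (simp add: assms(14) add_pos_nonneg less_imp_neq[symmetric])
  have "1 + \<nu> * cq > 0" using \<nu> pos by (simp add: add_pos_pos)
  then have c\<chi>: "c\<chi> > 0" unfolding assms(15) using cA by simp
  define \<kappa>0 where "\<kappa>0 = condition_bound ?d K0 \<nu> cq cA \<theta>"
  define c0 where "c0 = localization_const ?d K0 R \<nu> cq cA c\<chi> \<theta>"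
  define C1 where "C1 = (2 * R * cq) ^ ?d"
  define \<Lambda> where "\<Lambda> = c\<chi> * decay_sum ?d \<theta> + \<bar>local_lebesgue ?d \<kappa>0 \<nu> cq\<bar>"
  \<comment> \<open>The second summand makes room for the geometric series \<open>1 / (1 - \<mu> powr a)\<close> over the levels
    and for the factor \<open>2 * ch\<close>, which may be small.\<close>
  define c where "c = c0 + (if ?a > 0 then c0 / (2 * ch * (1 - \<mu> powr ?a)) else 0)"
  define Cn where "Cn = C1 + C1 * (\<nu> * \<mu> / ch) ^ ?d"
  have c0: "c0 > 0"
    unfolding c0_def localization_const_def interaction_bound_def
    using K0 R \<nu> pos cA c\<chi> decay_sum_pos[of \<theta> ?d] \<open>1 + \<nu> * cq > 0\<close> by simp
  have C1: "C1 > 0" unfolding C1_def using R pos by simp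
  have \<Lambda>0: "\<Lambda> > 0" unfolding \<Lambda>_def using c\<chi> decay_sum_pos[of \<theta> ?d] pos by (simp add: add_pos_nonneg)
  have \<mu>a: "\<mu> powr ?a < 1" if "?a > 0"
    using powr_less_mono2[of ?a \<mu> 1] that pos \<mu>1 by simp
  have c: "c0 \<le> c" unfolding c_def using c0 pos \<mu>a by auto
  have Cn: "C1 \<le> Cn" unfolding Cn_def using C1 \<nu> pos by simp
  have c_pos: "c > 0" and Cn_pos: "Cn > 0" using c c0 Cn C1 by linarith+
  show ?thesis
  proof (rule exI[of _ \<Lambda>], intro conjI[OF \<Lambda>0], rule exI[of _ c], intro conjI[OF c_pos],
      rule exI[of _ Cn], rule conjI[OF Cn_pos], (intro conjI allI impI; (elim conjE)?))
    fix X :: "nat \<Rightarrow> (real^'d) set" and L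
    assume adm: "admissible_points \<Omega> \<mu> ch cq cn \<gamma> \<nu> X L" and dec: "decay_bounds \<Phi> \<nu> \<Omega> \<theta> cA c\<chi> X L"
    let ?h = "\<lambda>l. fill_dist \<Omega> (X l)"
    have h_pos: "?h l > 0" if "l \<in> {1..L}" for l by (rule fill_dist_pos[OF adm that])
    have level: "\<exists>B. cardinal_level \<Phi> \<Omega> (X l) K0 R \<nu> cq cA c\<chi> \<theta> B" if "l \<in> {1..L}" for l
      using cardinal_level_of_admissible[OF ker K0 R \<nu> pos(3) cA c\<chi> pos(4) adm dec that] by blast
    have leb: "(\<Sum>x\<in>X l. \<bar>chi \<Phi> \<nu> \<Omega> (X l) x y\<bar>) \<le> \<Lambda>" if l: "l \<in> {1..L}" for l y
    proof -
      have "(\<Sum>x\<in>X l. \<bar>chi \<Phi> \<nu> \<Omega> (X l) x y\<bar>) \<le> c\<chi> * decay_sum ?d \<theta>"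
        using level[OF l] cardinal_level.chi_lebesgue by blast
      then show ?thesis unfolding \<Lambda>_def by linarith
    qed
    have leb': "(\<Sum>x\<in>X l. \<bar>local_chi \<Phi> \<nu> \<Omega> \<rho> (X l) x y\<bar>) \<le> \<Lambda>" if l: "l \<in> {1..L}" for l y
    proof -
      have "(\<Sum>x\<in>X l. \<bar>local_chi \<Phi> \<nu> \<Omega> \<rho> (X l) x y\<bar>) \<le> local_lebesgue ?d \<kappa>0 \<nu> cq"
        using level[OF l] cardinal_level.local_chi_lebesgue[OF _ \<rho>] unfolding \<kappa>0_def by blast
      also have "\<dots> \<le> \<Lambda>"
        unfolding \<Lambda>_def using c\<chi> decay_sum_pos[of \<theta> ?d] pos
        by (smt (verit) mult_pos_pos abs_ge_self)
      finally show ?thesis .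
    qed
    have diff: "\<bar>chi \<Phi> \<nu> \<Omega> (X l) x y - local_chi \<Phi> \<nu> \<Omega> \<rho> (X l) x y\<bar> \<le> c0 * ?h l powr (\<theta> * \<rho> - real ?d)"
      if l: "l \<in> {1..L}" "x \<in> X l" for l x y
      using level[OF l(1)] cardinal_level.chi_localization[OF _ l(2) \<rho>] unfolding c0_def by blast
    have card: "real (card (X l)) \<le> C1 / ?h l ^ ?d" if l: "l \<in> {1..L}" for l
      using level[OF l] cardinal_level.card_le unfolding C1_def by blast
    have cont: "continuous_on UNIV (chi \<Phi> \<nu> \<Omega> (X l) x)" "continuous_on UNIV (local_chi \<Phi> \<nu> \<Omega> \<rho> (X l) x)"
      if l: "l \<in> {1..L}" for l x
      using level[OF l]
      by (auto intro: cardinal_level.continuous_chi cardinal_level.continuous_local_chi)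
    show "(\<forall>l\<in>{1..L}.
       (\<forall>y. (\<Sum>x\<in>X l. \<bar>chi \<Phi> \<nu> \<Omega> (X l) x y\<bar>) \<le> \<Lambda>) \<and>
       (\<forall>x \<in> X l. Linf_norm \<Omega> (\<lambda>y. chi \<Phi> \<nu> \<Omega> (X l) x y - local_chi \<Phi> \<nu> \<Omega> \<rho> (X l) x y)
          \<le> ereal (c * ?h l powr (\<theta> * \<rho> - real ?d))) \<and>
       real (card (X l)) \<le> Cn * \<mu> powr (- real (?d * l)))"
    proof (intro ballI conjI allI)
      fix l assume l: "l \<in> {1..L}"
      show "(\<Sum>x\<in>X l. \<bar>chi \<Phi> \<nu> \<Omega> (X l) x y\<bar>) \<le> \<Lambda>" for y by (rule leb[OF l])
      show "Linf_norm \<Omega> (\<lambda>y. chi \<Phi> \<nu> \<Omega> (X l) x y - local_chi \<Phi> \<nu> \<Omega> \<rho> (X l) x y)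
          \<le> ereal (c * ?h l powr (\<theta> * \<rho> - real ?d))" if x: "x \<in> X l" for x
      proof (rule Linf_norm_le[OF continuous_on_diff[OF cont[OF l]] \<Omega>(1)])
        fix y
        have "c0 * ?h l powr (\<theta> * \<rho> - real ?d) \<le> c * ?h l powr (\<theta> * \<rho> - real ?d)"
          using c by (rule mult_right_mono) simp
        then show "ereal \<bar>chi \<Phi> \<nu> \<Omega> (X l) x y - local_chi \<Phi> \<nu> \<Omega> \<rho> (X l) x y\<bar>
            \<le> ereal (c * ?h l powr (\<theta> * \<rho> - real ?d))"
          using diff[OF l x, of y] by simp
      qed
      have "real (card (X l)) \<le> C1 * (1 / ?h l ^ ?d)" using card[OF l] by simp
      also have "\<dots> \<le> C1 * ((\<nu> * \<mu> / ch) ^ ?d * \<mu> powr (- real (?d * l)))"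
        using C1 by (intro mult_left_mono inverse_fill_dist_power_le[OF adm l pos(1,2) \<nu>]) auto
      also have "\<dots> \<le> Cn * \<mu> powr (- real (?d * l))"
        using C1 by (simp add: Cn_def algebra_simps)
      finally show "real (card (X l)) \<le> Cn * \<mu> powr (- real (?d * l))" .
    qed
    fix f :: "real^'d \<Rightarrow> real" and \<epsilon> :: "nat \<Rightarrow> real" and l
    assume sl: "?s < l" and lL: "l \<le> L"
    have l: "l \<in> {1..L}" using sl lL by simp
    let ?S = "adapt_points \<Phi> \<nu> \<Omega> X k \<mu> \<kappa> \<epsilon> L f"
    let ?e = "adapt_err \<Phi> \<nu> \<Omega> X k \<mu> \<kappa> \<epsilon> L f" and ?e' = "local_err \<Phi> \<nu> \<Omega> X k \<mu> \<kappa> \<rho> \<epsilon> L f"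
    let ?T = "\<lambda>j. c0 * C1 * ?h j powr ?a"
    let ?E = "linf_norm (adapt_points_upto \<Phi> \<nu> \<Omega> X k \<mu> \<kappa> \<epsilon> L f l) (class_err \<Phi> \<nu> \<Omega> X f ?s)"
    have sub: "?S j \<subseteq> X j" for j by (auto simp: adapt_points_def selected_points_def)
    have range: "j \<in> {1..L}" if "?s < j" "j \<le> L" for j using that by simp
    have fin: "finite (X j)" if "?s < j" for j using admissible_pointsD(1)[OF adm, of j] that by simp
    have close: "(\<Sum>x\<in>?S j. \<bar>chi \<Phi> \<nu> \<Omega> (X j) x y - local_chi \<Phi> \<nu> \<Omega> \<rho> (X j) x y\<bar>) \<le> ?T j"
      if j: "?s < j" "j \<le> L" for j y
    proof -
      note jL = range[OF j]
      have "(\<Sum>x\<in>?S j. \<bar>chi \<Phi> \<nu> \<Omega> (X j) x y - local_chi \<Phi> \<nu> \<Omega> \<rho> (X j) x y\<bar>)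
          \<le> (\<Sum>x\<in>X j. \<bar>chi \<Phi> \<nu> \<Omega> (X j) x y - local_chi \<Phi> \<nu> \<Omega> \<rho> (X j) x y\<bar>)"
        using fin[OF j(1)] sub by (intro sum_mono2) auto
      also have "\<dots> \<le> (\<Sum>x\<in>X j. c0 * ?h j powr (\<theta> * \<rho> - real ?d))"
        by (intro sum_mono diff jL)
      also have "\<dots> = real (card (X j)) * (c0 * ?h j powr (\<theta> * \<rho> - real ?d))" by simp
      also have "\<dots> \<le> C1 / ?h j ^ ?d * (c0 * ?h j powr (\<theta> * \<rho> - real ?d))"
        using c0 by (intro mult_right_mono card jL) auto
      also have "\<dots> = c0 * C1 * (?h j powr (\<theta> * \<rho> - real ?d) / ?h j powr real ?d)"
        using h_pos[OF jL] by (simp add: powr_realpow)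
      also have "?h j powr (\<theta> * \<rho> - real ?d) / ?h j powr real ?d = ?h j powr ?a"
        by (simp flip: powr_diff)
      finally show ?thesis .
    qed
    interpret it: perturbed_iteration "\<lambda>j. chi \<Phi> \<nu> \<Omega> (X j)" "\<lambda>j. local_chi \<Phi> \<nu> \<Omega> \<rho> (X j)" ?S ?e ?e' ?s L \<Lambda> ?T
      "\<lambda>l. \<Union>j\<in>{?s + 1..l}. ?S j" "\<lambda>l. linf_norm (\<Union>j\<in>{?s + 1..l}. ?S j) (?e ?s)"
    proof (rule perturbed_iteration.intro)
      fix j y assume j: "?s < j" "j \<le> L"
      show "finite (?S j)" by (rule finite_subset[OF sub fin[OF j(1)]])
      show "(\<Sum>x\<in>?S j. \<bar>chi \<Phi> \<nu> \<Omega> (X j) x y\<bar>) \<le> \<Lambda>"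
        using fin[OF j(1)] sub by (intro order.trans[OF sum_mono2 leb[OF range[OF j]]]) auto
      show "(\<Sum>x\<in>?S j. \<bar>local_chi \<Phi> \<nu> \<Omega> \<rho> (X j) x y\<bar>) \<le> \<Lambda>"
        using fin[OF j(1)] sub by (intro order.trans[OF sum_mono2 leb'[OF range[OF j]]]) auto
      show "(\<Sum>x\<in>?S j. \<bar>chi \<Phi> \<nu> \<Omega> (X j) x y - local_chi \<Phi> \<nu> \<Omega> \<rho> (X j) x y\<bar>) \<le> ?T j"
        by (rule close[OF j])
    next
      show "\<Lambda> \<ge> 0" using \<Lambda>0 by simp
      show "?e' ?s = ?e ?s" by (simp only: adapt_err_initial local_err_initial order.refl)
    next
      fix n y assume n: "?s \<le> n" "n < L"
      show "?e (Suc n) y = ?e n y - expansion (chi \<Phi> \<nu> \<Omega> (X (Suc n))) (?S (Suc n)) (?e n) y"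
        by (rule adapt_err_step[OF n(1)])
      show "?e' (Suc n) y = ?e' n y - expansion (local_chi \<Phi> \<nu> \<Omega> \<rho> (X (Suc n))) (?S (Suc n)) (?e' n) y"
        by (rule local_err_step[OF n(1)])
    qed
    have E: "linf_norm (\<Union>j\<in>{?s + 1..l}. ?S j) (?e ?s) = ?E"
      by (simp only: adapt_points_upto_def adapt_err_initial order.refl)
    have E0: "?E \<ge> 0" using it.E_nonneg[OF lL] unfolding E .
    have cont_err: "continuous_on UNIV (\<lambda>y. ?e' n y - ?e n y)" if "?s \<le> n" "n \<le> L" for n
      using that
    proof (induction n rule: dec_induct)
      case base
      then show ?case by (simp only: adapt_err_initial local_err_initial order.refl) simp
    next
      case (step n)
      have n: "Suc n \<in> {1..L}" using step by simp
      have old: "continuous_on UNIV (\<lambda>y. ?e' n y - ?e n y)" using step by simp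
      have "continuous_on UNIV (\<lambda>y. (?e' n y - ?e n y)
          - (expansion (local_chi \<Phi> \<nu> \<Omega> \<rho> (X (Suc n))) (?S (Suc n)) (?e' n) y
          - expansion (chi \<Phi> \<nu> \<Omega> (X (Suc n))) (?S (Suc n)) (?e n) y))"
        by (intro continuous_on_diff[OF old continuous_on_diff] continuous_expansion cont[OF n])
      then show ?case
        unfolding adapt_err_step[OF step(1)] local_err_step[OF step(1)] by (simp add: algebra_simps)
    qed
    show "Linf_norm \<Omega> (\<lambda>y. adapt_step \<Phi> \<nu> \<Omega> X k \<mu> \<kappa> \<epsilon> L f l y - local_step \<Phi> \<nu> \<Omega> X k \<mu> \<kappa> \<rho> \<epsilon> L f l y)
          \<le> ereal ((1 + \<Lambda>) ^ (l - ?s - 1) * ?E * c * Cn * ?h l powr ?a)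
            + ereal \<Lambda> * Linf_norm \<Omega> (\<lambda>y. ?e' (l - 1) y - ?e (l - 1) y)"
      (is "_ \<le> ereal ?B + ereal \<Lambda> * ?N")
    proof (rule Linf_norm_le[OF _ \<Omega>(1)])
      show "continuous_on UNIV (\<lambda>y. adapt_step \<Phi> \<nu> \<Omega> X k \<mu> \<kappa> \<epsilon> L f l y - local_step \<Phi> \<nu> \<Omega> X k \<mu> \<kappa> \<rho> \<epsilon> L f l y)"
        unfolding adapt_step_def local_step_def
        by (intro continuous_on_diff continuous_expansion cont[OF l])
      fix y
      have err: "ereal \<bar>?e' (l - 1) x - ?e (l - 1) x\<bar> \<le> ?N" if "x \<in> \<Omega>" for x
        using sl lL by (intro abs_le_Linf_norm cont_err \<Omega>(1) that) auto
      show "ereal \<bar>adapt_step \<Phi> \<nu> \<Omega> X k \<mu> \<kappa> \<epsilon> L f l y - local_step \<Phi> \<nu> \<Omega> X k \<mu> \<kappa> \<rho> \<epsilon> L f l y\<bar>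
          \<le> ereal ?B + ereal \<Lambda> * ?N"
      proof (cases ?N)
        case (real A)
        have A0: "A \<ge> 0" using \<Omega>(2) err unfolding real by force
        have "\<bar>?e' (l - 1) x - ?e (l - 1) x\<bar> \<le> A" if "x \<in> ?S l" for x
          using err[of x] sub[of l] that admissible_pointsD(3)[OF adm, of l] l unfolding real by auto
        from it.step_difference[OF sl lL this A0, of y]
        have "\<bar>adapt_step \<Phi> \<nu> \<Omega> X k \<mu> \<kappa> \<epsilon> L f l y - local_step \<Phi> \<nu> \<Omega> X k \<mu> \<kappa> \<rho> \<epsilon> L f l y\<bar>
            \<le> (1 + \<Lambda>) ^ (l - ?s - 1) * ?E * ?T l + \<Lambda> * A"
          unfolding E adapt_step_def local_step_def .
        also have "(1 + \<Lambda>) ^ (l - ?s - 1) * ?E * ?T l \<le> (1 + \<Lambda>) ^ (l - ?s - 1) * ?E * (c * Cn * ?h l powr ?a)"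
          using E0 \<Lambda>0 c Cn c0 C1 by (intro mult_left_mono mult_right_mono mult_mono mult_nonneg_nonneg) auto
        finally show ?thesis unfolding real by (simp add: mult.assoc)
      next
        case PInf
        then show ?thesis using \<Lambda>0 by simp
      next
        case MInf
        obtain x where "x \<in> \<Omega>" using \<Omega>(2) by blast
        with err[of x] MInf show ?thesis by simp
      qed
    qed
    assume "2 * real ?d < \<theta> * \<rho>"
    then have a: "?a > 0" by simp
    show "Linf_norm \<Omega> (\<lambda>y. ?e l y - ?e' l y)
       \<le> ereal (c * Cn * (1 + \<Lambda>) ^ (l - ?s - 1) * ?E * (2 * ch * ?h (?s + 1) powr ?a))"
    proof (rule Linf_norm_le[OF _ \<Omega>(1)])
      show "continuous_on UNIV (\<lambda>y. ?e l y - ?e' l y)"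
        using continuous_on_minus[OF cont_err[of l]] sl lL by simp
      fix y
      have pow: "(1 + \<Lambda>) ^ (l - ?s) = (1 + \<Lambda>) * (1 + \<Lambda>) ^ (l - ?s - 1)"
        using sl by (metis Suc_diff_Suc Suc_eq_plus1 diff_diff_add power_Suc)
      have "(1 + \<Lambda>) * \<bar>?e l y - ?e' l y\<bar> \<le> (1 + \<Lambda>) * ((1 + \<Lambda>) ^ (l - ?s - 1) * ?E * (\<Sum>j\<in>{?s<..l}. ?T j))"
        using it.error_difference[of l y] sl lL unfolding E pow by (simp add: mult.assoc)
      then have "\<bar>?e l y - ?e' l y\<bar> \<le> (1 + \<Lambda>) ^ (l - ?s - 1) * ?E * (\<Sum>j\<in>{?s<..l}. ?T j)"
        using \<Lambda>0 by (simp add: mult_le_cancel_left_pos)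
      also have "(\<Sum>j\<in>{?s<..l}. ?T j) = c0 * C1 * (\<Sum>j\<in>{?s<..l}. ?h j powr ?a)"
        by (simp add: sum_distrib_left)
      also have "\<dots> \<le> c0 * C1 * (?h (Suc ?s) powr ?a / (1 - \<mu> powr ?a))"
      proof (intro mult_left_mono sum_powr_geometric_le a pos(1) \<mu>1 sl)
        show "?h (Suc j) \<le> \<mu> * ?h j" if "?s < j" "j < l" for j
          using admissible_pointsD(4)[OF adm, of j] that lL by simp
      qed (use h_pos lL c0 C1 in auto)
      also have "\<dots> = C1 * (c0 / (2 * ch * (1 - \<mu> powr ?a))) * (2 * ch * ?h (Suc ?s) powr ?a)"
        using pos by simp
      also have "\<dots> \<le> Cn * c * (2 * ch * ?h (Suc ?s) powr ?a)"
        using Cn C1 c0 pos \<mu>a[OF a] a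
        by (intro mult_right_mono mult_mono) (auto simp: c_def)
      finally have "\<bar>?e l y - ?e' l y\<bar> \<le> (1 + \<Lambda>) ^ (l - ?s - 1) * ?E * (Cn * c * (2 * ch * ?h (Suc ?s) powr ?a))"
        using E0 \<Lambda>0 by (simp add: mult_left_mono)
      then show "ereal \<bar>?e l y - ?e' l y\<bar> \<le> ereal (c * Cn * (1 + \<Lambda>) ^ (l - ?s - 1) * ?E * (2 * ch * ?h (?s + 1) powr ?a))"
        by (simp add: mult_ac)
    qed
  qed
qed

end
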